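(* Let $(M,J)$ be a $2n$-dimensional almost complex manifold and let $x\in M$. If $J$ satisfies the line condition at $x$, then there exists an almost complex blow-up $(\tilde{M}_x,\tilde{J})$ of $(M,J)$ at $x$.
   Context: An almost complex structure on a smooth $2n$-manifold $M$ is a smooth $J\in\mathrm{End}(TM)$ with $J^2=-\mathrm{id}$ (not assumed integrable). A smooth map $f:(M,J)\to(M',J')$ is pseudoholomorphic (or $(J,J')$-pseudoholomorphic) if $J'\circ df=df\circ J$. Line condition. $J$ satisfies the line condition at $x\in M$ if there is a smooth local chart $(\mathcal{U},\phi)$, with $0\in\mathcal{U}\subset\mathbb{C}^n$ open, $\phi:\mathcal{U}\to\phi(\mathcal{U})\subset M$, $\phi(0)=x$, such that, writing $\mathbb{J}=d\phi^{-1}\circ J\circ d\phi$, for every $q=(q_1,\ldots,q_n)\in\mathcal{U}$ the structure $\mathbb{J}_q$ coincides with $i$ (the standard complex structure) on the complex subspace $\mathrm{Span}_{\mathbb{C}}\langle q\rangle$ of $T_q\mathbb{C}^n=\mathbb{C}^n$ spanned by $q$, and the structure induced by $\mathbb{J}_q$ on the quotient $T_q\mathbb{C}^n/\mathrm{Span}_{\mathbb{C}}\langle q\rangle$ (by $[v]\mapsto[\mathbb{J}_qv]$) also coincides with $i$. Almost complex blow-up. Let $(\mathcal{U},\phi)$ be a smooth local chart at $x$ with $0\in\mathcal{U}\subset\mathbb{C}^n$, $\phi(0)=x$. Let $\mathcal{B}=\{((z_1,\ldots,z_n),[v_1:\ldots:v_n])\in\mathcal{U}\times\mathbb{P}^{n-1}(\mathbb{C})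 : z_iv_j-z_jv_i=0,\ i,j=1,\ldots,n\}$. Let $\tilde{M}_x$ be the smooth manifold $((M\setminus\{x\})\cup\mathcal{B})/\sim$, where $\phi(z)\sim(z,[z])$ for $z\neq 0$, and let $\pi:\tilde{M}_x\to M$ be $\pi(z,[v])=\phi(z)$ on $\mathcal{B}$ and $\pi(y)=y$ for $y\in M\setminus\{x\}$. An almost complex blow-up of $M$ at $x$ with respect to $(\mathcal{U},\phi)$ is a (smooth) almost complex structure $\tilde{J}$ on $\tilde{M}_x$ such that $\pi$ is $(\tilde{J},J)$-pseudoholomorphic. An almost complex blow-up of $(M,J)$ at $x$ is one with respect to some smooth local chart at $x$. *)

theory Defs
  imports "HOL-Analysis.Analysis"
begin

section \<open>Smooth functions on open subsets of a Euclidean space\<close>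

primrec Ck_on :: "nat \<Rightarrow> 'e::euclidean_space set \<Rightarrow> ('e \<Rightarrow> 'f::euclidean_space) \<Rightarrow> bool" where
  "Ck_on 0 S f \<longleftrightarrow> continuous_on S f"
| "Ck_on (Suc k) S f \<longleftrightarrow>
     (\<forall>x\<in>S. f differentiable (at x)) \<and> (\<forall>v. Ck_on k S (\<lambda>x. frechet_derivative f (at x) v))"

text \<open>Real $C^\infty$ smoothness; only meaningful for open S.\<close>

definition smooth_on :: "'e::euclidean_space set \<Rightarrow> ('e \<Rightarrow> 'f::euclidean_space) \<Rightarrow> bool" where
  "smooth_on S f \<longleftrightarrow> (\<forall>k. Ck_on k S f)"


section \<open>Smooth manifolds\<close>

text \<open>A chart is a pair of an open subset \<open>D\<close> of the model space \<open>'e\<close> and a map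
  \<open>\<phi> : D \<rightarrow> M\<close>, i.e. charts go from the model space into the manifold. The total function
  \<open>\<phi>\<close> carries no information outside \<open>D\<close>. A manifold of dimension 2n is modelled on
  \<open>complex ^ 'n\<close>, regarded as a real vector space, where n = \<open>CARD('n)\<close>.\<close>

type_synonym ('a, 'e) chart = "'e set \<times> ('e \<Rightarrow> 'a)"

record ('a, 'e) mfd =
  pts :: "'a set"
  atlas :: "('a, 'e) chart set"

abbreviation cimage :: "('a, 'e) chart \<Rightarrow> 'a set" where
  "cimage c \<equiv> snd c ` fst c"

abbreviation coord :: "('a, 'e) chart \<Rightarrow> 'a \<Rightarrow> 'e" where
  "coord c \<equiv> inv_into (fst c) (snd c)"

text \<open>The coordinate expression of \<open>f\<close> with respect to the charts \<open>c\<close> and \<open>d\<close> is defined on an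
  open set and is smooth there.\<close>

definition smooth_in_charts ::
  "('a, 'e::euclidean_space) chart \<Rightarrow> ('b, 'f::euclidean_space) chart \<Rightarrow> ('a \<Rightarrow> 'b) \<Rightarrow> bool" where
  "smooth_in_charts c d f \<longleftrightarrow>
     (let W = {z \<in> fst c. f (snd c z) \<in> cimage d}
      in open W \<and> smooth_on W (\<lambda>z. coord d (f (snd c z))))"

definition compatible ::
  "('a, 'e::euclidean_space) chart \<Rightarrow> ('a, 'e) chart \<Rightarrow> bool" where
  "compatible c d \<longleftrightarrow> smooth_in_charts c d (\<lambda>p. p) \<and> smooth_in_charts d c (\<lambda>p. p)"

text \<open>The charts of the maximal atlas.\<close>

definition smooth_chart :: "('a, 'e::euclidean_space) mfd \<Rightarrow> ('a, 'e) chart \<Rightarrow> bool" where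
  "smooth_chart M c \<longleftrightarrow>
     open (fst c) \<and> inj_on (snd c) (fst c) \<and> cimage c \<subseteq> pts M \<and> (\<forall>d\<in>atlas M. compatible c d)"

text \<open>The topology of a manifold is the one determined by its atlas.\<close>

definition mfd_topology :: "('a, 'e::euclidean_space) mfd \<Rightarrow> 'a topology" where
  "mfd_topology M =
     topology (\<lambda>W. W \<subseteq> pts M \<and> (\<forall>c\<in>atlas M. open {z \<in> fst c. snd c z \<in> W}))"

lemma openin_mfd_topology:
  "openin (mfd_topology M) W \<longleftrightarrow>
     W \<subseteq> pts M \<and> (\<forall>c\<in>atlas M. open {z \<in> fst c. snd c z \<in> W})"
proof -
  have "istopology (\<lambda>W. W \<subseteq> pts M \<and> (\<forall>c\<in>atlas M. open {z \<in> fst c. snd c z \<in> W}))"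
    unfolding istopology_def
  proof (intro conjI allI impI)
    fix S T
    assume "S \<subseteq> pts M \<and> (\<forall>c\<in>atlas M. open {z \<in> fst c. snd c z \<in> S})"
      and "T \<subseteq> pts M \<and> (\<forall>c\<in>atlas M. open {z \<in> fst c. snd c z \<in> T})"
    moreover have "{z \<in> fst c. snd c z \<in> S \<inter> T} =
        {z \<in> fst c. snd c z \<in> S} \<inter> {z \<in> fst c. snd c z \<in> T}" for c :: "('a, 'b) chart"
      by auto
    ultimately show "S \<inter> T \<subseteq> pts M" "\<forall>c\<in>atlas M. open {z \<in> fst c. snd c z \<in> S \<inter> T}"
      by auto
  next
    fix K
    assume K: "\<forall>S\<in>K. S \<subseteq> pts M \<and> (\<forall>c\<in>atlas M. open {z \<in> fst c. snd c z \<in> S})"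
    then show "\<Union>K \<subseteq> pts M"
      by auto
    have "{z \<in> fst c. snd c z \<in> \<Union>K} = (\<Union>S\<in>K. {z \<in> fst c. snd c z \<in> S})"
      for c :: "('a, 'b) chart"
      by auto
    with K show "\<forall>c\<in>atlas M. open {z \<in> fst c. snd c z \<in> \<Union>K}"
      by auto
  qed
  then show ?thesis
    by (simp add: mfd_topology_def)
qed

definition smooth_manifold :: "('a, 'e::euclidean_space) mfd \<Rightarrow> bool" where
  "smooth_manifold M \<longleftrightarrow>
     (\<forall>c\<in>atlas M. smooth_chart M c) \<and> (\<Union>c\<in>atlas M. cimage c) = pts M \<and>
     Hausdorff_space (mfd_topology M) \<and> second_countable (mfd_topology M)"

definition smooth_map ::
  "('a, 'e::euclidean_space) mfd \<Rightarrow> ('b, 'f::euclidean_space) mfd \<Rightarrow> ('a \<Rightarrow> 'b) \<Rightarrow> bool" where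
  "smooth_map M N f \<longleftrightarrow>
     f ` pts M \<subseteq> pts N \<and> (\<forall>c\<in>atlas M. \<forall>d\<in>atlas N. smooth_in_charts c d f)"


section \<open>Tangent vectors and differentials\<close>

text \<open>A tangent vector at \<open>p\<close> is a family of coordinate vectors, one for each smooth chart
  around \<open>p\<close>, which transforms by the derivatives of the transition maps. The value 0 at the
  remaining charts makes this representation unique.\<close>

type_synonym ('a, 'e) tvec = "('a, 'e) chart \<Rightarrow> 'e"

definition chart_at :: "('a, 'e::euclidean_space) mfd \<Rightarrow> 'a \<Rightarrow> ('a, 'e) chart \<Rightarrow> bool" where
  "chart_at M p c \<longleftrightarrow> smooth_chart M c \<and> p \<in> cimage c"

definition tangent_space :: "('a, 'e::euclidean_space) mfd \<Rightarrow> 'a \<Rightarrow> ('a, 'e) tvec set" where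
  "tangent_space M p =
     {X. (\<forall>c. \<not> chart_at M p c \<longrightarrow> X c = 0) \<and>
         (\<forall>c d. chart_at M p c \<and> chart_at M p d \<longrightarrow>
            X d = frechet_derivative (\<lambda>z. coord d (snd c z)) (at (coord c p)) (X c))}"

text \<open>For a chart \<open>c = (D, \<phi>)\<close> and \<open>q \<in> D\<close>, \<open>dchart M c q\<close> is the isomorphism
  $d\phi_q$ from \<open>'e\<close> onto the tangent space at $\phi(q)$. Its inverse is
  \<open>\<lambda>X. X c\<close>.\<close>

definition dchart ::
  "('a, 'e::euclidean_space) mfd \<Rightarrow> ('a, 'e) chart \<Rightarrow> 'e \<Rightarrow> 'e \<Rightarrow> ('a, 'e) tvec" where
  "dchart M c q v =
     (\<lambda>d. if chart_at M (snd c q) d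
          then frechet_derivative (\<lambda>z. coord d (snd c z)) (at q) v else 0)"

text \<open>The differential $df_p$, computed in an arbitrary chart \<open>c\<close> around \<open>p\<close>; by the chain rule
  the result does not depend on the choice of \<open>c\<close>.\<close>

definition tangent_map ::
  "('a, 'e::euclidean_space) mfd \<Rightarrow> ('b, 'f::euclidean_space) mfd \<Rightarrow> ('a \<Rightarrow> 'b) \<Rightarrow> 'a \<Rightarrow>
     ('a, 'e) tvec \<Rightarrow> ('b, 'f) tvec" where
  "tangent_map M N f p X =
     (let c = (SOME c. chart_at M p c)
      in (\<lambda>d. if chart_at N (f p) d
              then frechet_derivative (\<lambda>z. coord d (f (snd c z))) (at (coord c p)) (X c) else 0))"


section \<open>Almost complex structures\<close>

type_synonym ('a, 'e) tangent_endo = "'a \<Rightarrow> ('a, 'e) tvec \<Rightarrow> ('a, 'e) tvec"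

text \<open>The structure $d\phi^{-1}\circ J\circ d\phi$ at \<open>q\<close>, where \<open>c = (D, \<phi>)\<close>.\<close>

definition pullback_endo ::
  "('a, 'e::euclidean_space) mfd \<Rightarrow> ('a, 'e) tangent_endo \<Rightarrow> ('a, 'e) chart \<Rightarrow> 'e \<Rightarrow> 'e \<Rightarrow> 'e" where
  "pullback_endo M J c q v = J (snd c q) (dchart M c q v) c"

definition almost_complex_structure ::
  "('a, 'e::euclidean_space) mfd \<Rightarrow> ('a, 'e) tangent_endo \<Rightarrow> bool" where
  "almost_complex_structure M J \<longleftrightarrow>
     (\<forall>p\<in>pts M.
        (\<forall>X\<in>tangent_space M p. J p X \<in> tangent_space M p) \<and>
        (\<forall>X\<in>tangent_space M p. \<forall>Y\<in>tangent_space M p. \<forall>a b :: real.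
           J p (\<lambda>c. a *\<^sub>R X c + b *\<^sub>R Y c) = (\<lambda>c. a *\<^sub>R J p X c + b *\<^sub>R J p Y c)) \<and>
        (\<forall>X\<in>tangent_space M p. J p (J p X) = (\<lambda>c. - X c))) \<and>
     (\<forall>c\<in>atlas M. \<forall>v. smooth_on (fst c) (\<lambda>q. pullback_endo M J c q v))"

definition almost_complex_manifold ::
  "('a, 'e::euclidean_space) mfd \<Rightarrow> ('a, 'e) tangent_endo \<Rightarrow> bool" where
  "almost_complex_manifold M J \<longleftrightarrow> smooth_manifold M \<and> almost_complex_structure M J"

definition pseudoholomorphic ::
  "('a, 'e::euclidean_space) mfd \<Rightarrow> ('a, 'e) tangent_endo \<Rightarrow>
   ('b, 'f::euclidean_space) mfd \<Rightarrow> ('b, 'f) tangent_endo \<Rightarrow> ('a \<Rightarrow> 'b) \<Rightarrow> bool" where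
  "pseudoholomorphic M J N J' f \<longleftrightarrow>
     smooth_map M N f \<and>
     (\<forall>p\<in>pts M. \<forall>X\<in>tangent_space M p.
        J' (f p) (tangent_map M N f p X) = tangent_map M N f p (J p X))"


section \<open>The line condition\<close>

definition smooth_local_chart_at_origin ::
  "('a, complex ^ 'n) mfd \<Rightarrow> 'a \<Rightarrow> ('a, complex ^ 'n) chart \<Rightarrow> bool" where
  "smooth_local_chart_at_origin M x c \<longleftrightarrow> smooth_chart M c \<and> 0 \<in> fst c \<and> snd c 0 = x"

text \<open>\<open>vec.span {q}\<close> is the complex span of \<open>q\<close>. The second conjunct is the equality
  $[\mathbb{J}_q v] = [i v]$ of classes in the quotient by this span.\<close>

definition line_condition ::
  "('a, complex ^ 'n) mfd \<Rightarrow> ('a, complex ^ 'n) tangent_endo \<Rightarrow> 'a \<Rightarrow> bool" where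
  "line_condition M J x \<longleftrightarrow>
     (\<exists>c. smooth_local_chart_at_origin M x c \<and>
        (\<forall>q\<in>fst c.
           (\<forall>v\<in>vec.span {q}. pullback_endo M J c q v = \<i> *s v) \<and>
           (\<forall>v. pullback_endo M J c q v - \<i> *s v \<in> vec.span {q})))"


section \<open>The blow-up manifold\<close>

text \<open>Points of complex projective space are the complex lines through the origin;
  \<open>proj_point v\<close> is the point with homogeneous coordinates \<open>v \<noteq> 0\<close>.\<close>

definition proj_point :: "complex ^ 'n \<Rightarrow> (complex ^ 'n) set" where
  "proj_point v = vec.span {v}"

definition blowup_model :: "(complex ^ 'n) set \<Rightarrow> ((complex ^ 'n) \<times> (complex ^ 'n) set) set" where
  "blowup_model U =
     {(z, proj_point v) | z v. z \<in> U \<and> v \<noteq> 0 \<and> (\<forall>i j. z $ i * v $ j - z $ j * v $ i = 0)}"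

text \<open>The smooth structure of \<open>blowup_model U\<close> is given by its standard affine charts: where the
  \<open>i\<close>-th homogeneous coordinate does not vanish, normalise it to 1, use the other homogeneous
  coordinates and take \<open>z $ i\<close> as the remaining coordinate (stored in the \<open>i\<close>-th place).\<close>

definition affine_vec :: "'n \<Rightarrow> complex ^ 'n \<Rightarrow> complex ^ 'n" where
  "affine_vec i w = (\<chi> j. if j = i then 1 else w $ j)"

definition affine_chart ::
  "(complex ^ 'n) set \<Rightarrow> 'n \<Rightarrow> ((complex ^ 'n) \<times> (complex ^ 'n) set, complex ^ 'n) chart" where
  "affine_chart U i =
     ({w. w $ i *s affine_vec i w \<in> U},
      \<lambda>w. (w $ i *s affine_vec i w, proj_point (affine_vec i w)))"

type_synonym ('a, 'n) blowup_pre = "'a + (complex ^ 'n) \<times> (complex ^ 'n) set"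

text \<open>The disjoint union of $M \setminus \{x\}$ and the model, and the equivalence relation on it
  generated by $\phi(z) \sim (z, [z])$ for nonzero z, where \<open>c = (U, \<phi>)\<close>.\<close>

definition blowup_pre ::
  "('a, complex ^ 'n) mfd \<Rightarrow> 'a \<Rightarrow> ('a, complex ^ 'n) chart \<Rightarrow> ('a, 'n) blowup_pre set" where
  "blowup_pre M x c = Inl ` (pts M - {x}) \<union> Inr ` blowup_model (fst c)"

definition blowup_rel ::
  "('a, complex ^ 'n) mfd \<Rightarrow> 'a \<Rightarrow> ('a, complex ^ 'n) chart \<Rightarrow> ('a, 'n) blowup_pre rel" where
  "blowup_rel M x c =
     (let r = {(Inl (snd c z), Inr (z, proj_point z)) | z. z \<in> fst c \<and> z \<noteq> 0}
      in (r \<union> r\<inverse>)\<^sup>* \<inter> blowup_pre M x c \<times> blowup_pre M x c)"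

definition blowup_class ::
  "('a, complex ^ 'n) mfd \<Rightarrow> 'a \<Rightarrow> ('a, complex ^ 'n) chart \<Rightarrow> ('a, 'n) blowup_pre \<Rightarrow>
     ('a, 'n) blowup_pre set" where
  "blowup_class M x c s = blowup_rel M x c `` {s}"

definition blowup ::
  "('a, complex ^ 'n) mfd \<Rightarrow> 'a \<Rightarrow> ('a, complex ^ 'n) chart \<Rightarrow>
     (('a, 'n) blowup_pre set, complex ^ 'n) mfd" where
  "blowup M x c =
     \<lparr> pts = blowup_pre M x c // blowup_rel M x c,
       atlas =
         {({z \<in> fst d. snd d z \<noteq> x}, \<lambda>z. blowup_class M x c (Inl (snd d z))) | d. d \<in> atlas M} \<union>
         {(fst d, \<lambda>w. blowup_class M x c (Inr (snd d w))) | d. d \<in> range (affine_chart (fst c))} \<rparr>"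

text \<open>The projection, defined on representatives; all representatives of a point of the blow-up
  have the same image.\<close>

fun blow_down_pre :: "('a, complex ^ 'n) chart \<Rightarrow> ('a, 'n) blowup_pre \<Rightarrow> 'a" where
  "blow_down_pre c (Inl y) = y"
| "blow_down_pre c (Inr (z, L)) = snd c z"

definition blow_down :: "('a, complex ^ 'n) chart \<Rightarrow> ('a, 'n) blowup_pre set \<Rightarrow> 'a" where
  "blow_down c C = the_elem (blow_down_pre c ` C)"

definition almost_complex_blowup_wrt ::
  "('a, complex ^ 'n) mfd \<Rightarrow> ('a, complex ^ 'n) tangent_endo \<Rightarrow> 'a \<Rightarrow>
   ('a, complex ^ 'n) chart \<Rightarrow> (('a, 'n) blowup_pre set, complex ^ 'n) tangent_endo \<Rightarrow> bool" where
  "almost_complex_blowup_wrt M J x c Jt \<longleftrightarrow>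
     smooth_local_chart_at_origin M x c \<and>
     almost_complex_manifold (blowup M x c) Jt \<and>
     pseudoholomorphic (blowup M x c) Jt M J (blow_down c)"

definition almost_complex_blowup ::
  "('a, complex ^ 'n) mfd \<Rightarrow> ('a, complex ^ 'n) tangent_endo \<Rightarrow> 'a \<Rightarrow>
   (('a, 'n) blowup_pre set, complex ^ 'n) mfd \<Rightarrow>
   (('a, 'n) blowup_pre set, complex ^ 'n) tangent_endo \<Rightarrow> bool" where
  "almost_complex_blowup M J x Mt Jt \<longleftrightarrow>
     (\<exists>c. Mt = blowup M x c \<and> almost_complex_blowup_wrt M J x c Jt)"


subsection \<open>Consistency of the constructions\<close>

lemma affine_charts_cover: "(\<Union>i. cimage (affine_chart U i)) = blowup_model U"
proof (intro equalityI subsetI)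
  fix p assume "p \<in> (\<Union>i. cimage (affine_chart U i))"
  then obtain i w where "w $ i *s affine_vec i w \<in> U"
    and p: "p = (w $ i *s affine_vec i w, proj_point (affine_vec i w))"
    by (auto simp: affine_chart_def)
  moreover have "affine_vec i w $ i = 1"
    by (simp add: affine_vec_def)
  then have "affine_vec i w \<noteq> 0"
    by force
  ultimately show "p \<in> blowup_model U"
    unfolding blowup_model_def by (auto intro!: exI[of _ "affine_vec i w"])
next
  fix p assume "p \<in> blowup_model U"
  then obtain z v where p: "p = (z, proj_point v)" and z: "z \<in> U" and v: "v \<noteq> 0"
    and eq: "\<And>i j. z $ i * v $ j - z $ j * v $ i = 0"
    by (auto simp: blowup_model_def)
  from v obtain i where i: "v $ i \<noteq> 0"
    by (auto simp: vec_eq_iff)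
  define w where "w = (\<chi> j. if j = i then z $ i else v $ j / v $ i)"
  have u: "affine_vec i w = inverse (v $ i) *s v"
    using i by (auto simp: vec_eq_iff affine_vec_def w_def field_simps)
  have "z $ i * v $ j = z $ j * v $ i" for j
    using eq[of i j] by simp
  then have "w $ i *s affine_vec i w = z"
    using i by (auto simp: vec_eq_iff u) (auto simp: w_def field_simps)
  moreover have "proj_point (affine_vec i w) = proj_point v"
  proof -
    have "v = v $ i *s (inverse (v $ i) *s v)"
      using i by (simp add: vec_eq_iff)
    then have "v \<in> vec.span {inverse (v $ i) *s v}"
      by (metis vec.span_scale vec.span_base singletonI)
    moreover have "inverse (v $ i) *s v \<in> vec.span {v}"
      by (simp add: vec.span_scale vec.span_base)
    ultimately show ?thesis
      unfolding u proj_point_def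
      by (intro vec.span_eq[THEN iffD2]) auto
  qed
  ultimately have "p \<in> cimage (affine_chart U i)"
    using z p by (auto simp: affine_chart_def image_iff intro!: exI[of _ w])
  then show "p \<in> (\<Union>i. cimage (affine_chart U i))"
    by blast
qed

lemma equiv_blowup_rel: "equiv (blowup_pre M x c) (blowup_rel M x c)"
proof (rule equivI)
  show "sym (blowup_rel M x c)"
    unfolding blowup_rel_def Let_def
    by (intro sym_Int sym_rtrancl sym_Un_converse) (auto simp: sym_def)
  show "trans (blowup_rel M x c)"
    unfolding blowup_rel_def Let_def
    by (intro trans_Int trans_rtrancl) (auto simp: trans_def)
qed (auto simp: blowup_rel_def refl_on_def Let_def)

lemma blow_down_class:
  assumes "s \<in> blowup_pre M x c"
  shows "blow_down c (blowup_class M x c s) = blow_down_pre c s"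
proof -
  have "blow_down_pre c t = blow_down_pre c s" if "(s, t) \<in> blowup_rel M x c" for t
  proof -
    have "(s, t) \<in> ({(Inl (snd c z), Inr (z, proj_point z)) | z. z \<in> fst c \<and> z \<noteq> 0} \<union>
        {(Inl (snd c z), Inr (z, proj_point z)) | z. z \<in> fst c \<and> z \<noteq> 0}\<inverse>)\<^sup>*"
      using that by (simp add: blowup_rel_def Let_def)
    then show ?thesis
      by (induction rule: rtrancl_induct) auto
  qed
  moreover have "(s, s) \<in> blowup_rel M x c"
    using assms by (auto simp: blowup_rel_def Let_def)
  ultimately have "blow_down_pre c ` blowup_class M x c s = {blow_down_pre c s}"
    unfolding blowup_class_def by blast
  then show ?thesis
    by (simp add: blow_down_def)
qed

end

theory Submission
  imports Defs
begin

text \<open>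
  Let \<open>U\<close> be the domain of the chart of the line condition and \<open>J\<close> the structure read in it. In the
  \<open>i\<close>-th affine chart of the blow-up the projection to \<open>M\<close> becomes
  $\beta(w) = w_i u$, where $u$ is $w$ with the \<open>i\<close>-th entry replaced by 1. A structure $K$ on
  the blow-up makes the projection pseudoholomorphic iff $d\beta_w \circ K_w = J_{\beta(w)} \circ d\beta_w$.
  Where $w_i \neq 0$, this determines $K_w$; the question is whether $K$ extends smoothly to
  the exceptional divisor $w_i = 0$.

  The line condition says that $J_q y = i y + \lambda_q(y) q$ for a complex number
  $\lambda_q(y)$. Now $\beta(w) = w_i u = d\beta_w(w_i e_i)$ and $d\beta_w$ is complex linear, so
  $d\beta_w^{-1} J_{\beta(w)} d\beta_w h = i h + \lambda w_i e_i$ with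
  $\lambda = \lambda_{\beta(w)}(d\beta_w h)$. The coefficient $\lambda w_i$ is the \<open>i\<close>-th
  entry of $\lambda \beta(w) = J_{\beta(w)} d\beta_w h - i\, d\beta_w h$. Hence
  \[ K_w h = i h + (J_{\beta(w)} d\beta_w h - i\, d\beta_w h)_i\, e_i , \]
  a formula without division that is smooth on the whole affine chart. On the exceptional divisor it
  is multiplication with $i$, because $J_0 = i$. This is \<open>lifted_endo\<close>, and its properties are
  \<open>lifted_endo_intertwines\<close>, \<open>lifted_endo_square\<close> and \<open>smooth_lifted_endo\<close>.

  The local structures fit together (\<open>blowup_endo_transition\<close>): off the exceptional divisor they are
  all intertwined with \<open>J\<close> by the injective differential of the projection, and on it they are
  multiplication with $i$, which commutes with the differentials of the rational changes of affine
  coordinates (\<open>affine_transition_derivative\<close>).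

  The remaining work is the manifold theory behind these statements: smooth maps are closed under
  composition (\<open>smooth_on_compose\<close>), tangent maps and almost complex structures can be handled in
  arbitrary charts of the maximal atlas (\<open>d_in_charts_compose\<close>, \<open>smooth_pullback_endo\<close>), compatible
  local structures define a global one (locale \<open>local_endos\<close>), and the blow-up is a manifold
  (\<open>smooth_manifold_blowup\<close>).
\<close>

section \<open>Calculus of smooth maps between Euclidean spaces\<close>

lemma Ck_on_cong:
  assumes "open S" "\<And>x. x \<in> S \<Longrightarrow> f x = g x" "Ck_on k S f"
  shows "Ck_on k S g"
  using assms(2,3)
proof (induction k arbitrary: f g)
  case 0
  then show ?case by (simp cong: continuous_on_cong)
next
  case (Suc k)
  have d: "(g has_derivative frechet_derivative f (at x)) (at x)" if "x \<in> S" for x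
    by (rule has_derivative_transform_within_open[OF _ assms(1) that Suc.prems(1)])
      (use Suc.prems(2) that in \<open>simp_all add: frechet_derivative_works\<close>)
  have "g differentiable (at x)" if "x \<in> S" for x
    using d[OF that] by (auto simp: differentiable_def)
  moreover have "Ck_on k S (\<lambda>x. frechet_derivative g (at x) v)" for v
  proof (rule Suc.IH)
    show "Ck_on k S (\<lambda>x. frechet_derivative f (at x) v)"
      using Suc.prems by simp
    show "frechet_derivative f (at x) v = frechet_derivative g (at x) v" if "x \<in> S" for x
      using frechet_derivative_at[OF d[OF that]] by simp
  qed
  ultimately show ?case by simp
qed

lemma Ck_on_SucI:
  assumes "open S" "\<And>x. x \<in> S \<Longrightarrow> (f has_derivative f' x) (at x)"
    and "\<And>v. Ck_on k S (\<lambda>x. f' x v)"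
  shows "Ck_on (Suc k) S f"
proof -
  have "f' x v = frechet_derivative f (at x) v" if "x \<in> S" for x v
    using frechet_derivative_at[OF assms(2)[OF that]] by simp
  then have "Ck_on k S (\<lambda>x. frechet_derivative f (at x) v)" for v
    by (rule Ck_on_cong[OF assms(1) _ assms(3)])
  then show ?thesis
    using assms(2) by (auto simp: differentiable_def)
qed

lemma Ck_on_Suc_has_derivative:
  "Ck_on (Suc k) S f \<Longrightarrow> x \<in> S \<Longrightarrow> (f has_derivative frechet_derivative f (at x)) (at x)"
  by (simp add: frechet_derivative_works[THEN iffD1])

lemma Ck_on_SucD: "Ck_on (Suc k) S f \<Longrightarrow> Ck_on k S f"
proof (induction k arbitrary: f)
  case 0
  then show ?case
    by (auto intro!: continuous_at_imp_continuous_on differentiable_imp_continuous_within)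
qed auto

lemma Ck_on_subset: "Ck_on k S f \<Longrightarrow> T \<subseteq> S \<Longrightarrow> Ck_on k T f"
  by (induction k arbitrary: f) (auto intro: continuous_on_subset)

text \<open>Locality matters because a transition map of the maximal atlas is only locally a composition of
  transition maps of the given atlas.\<close>

lemma Ck_on_local:
  assumes "\<And>x. x \<in> S \<Longrightarrow> \<exists>T. open T \<and> x \<in> T \<and> Ck_on k T f"
  shows "Ck_on k S f"
  using assms
proof (induction k arbitrary: f)
  case 0
  show ?case
    using 0 by (auto intro!: continuous_at_imp_continuous_on simp: continuous_on_eq_continuous_at)
      (metis continuous_on_eq_continuous_at)
next
  case (Suc k)
  have "f differentiable (at x)" if "x \<in> S" for x
    using Suc.prems[OF that] by auto
  moreover have "Ck_on k S (\<lambda>x. frechet_derivative f (at x) v)" for v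
    by (rule Suc.IH) (use Suc.prems in \<open>simp, blast\<close>)
  ultimately show ?case by simp
qed

lemma Ck_on_const: "open S \<Longrightarrow> Ck_on k S (\<lambda>x. c)"
proof (induction k arbitrary: c)
  case (Suc k)
  then show ?case by simp
qed simp

lemma Ck_on_bounded_linear:
  assumes "bounded_linear L" "open S" "Ck_on k S f"
  shows "Ck_on k S (\<lambda>x. L (f x))"
  using assms(3)
proof (induction k arbitrary: f)
  case 0
  then show ?case
    using bounded_linear.continuous_on[OF assms(1)] by simp
next
  case (Suc k)
  show ?case
    by (rule Ck_on_SucI[OF assms(2)
          bounded_linear.has_derivative[OF assms(1) Ck_on_Suc_has_derivative[OF Suc.prems]]])
      (use Suc in auto)
qed

lemma Ck_on_ident: "open S \<Longrightarrow> Ck_on k S (\<lambda>x. x)"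
proof (cases k)
  case (Suc n)
  assume "open S"
  then show ?thesis
    unfolding Suc by (intro Ck_on_SucI[where f' = "\<lambda>x v. v"]) (auto intro: Ck_on_const)
qed (simp)

lemma Ck_on_add:
  assumes "open S" "Ck_on k S f" "Ck_on k S g"
  shows "Ck_on k S (\<lambda>x. f x + g x)"
  using assms(2,3)
proof (induction k arbitrary: f g)
  case 0
  then show ?case by (simp add: continuous_on_add)
next
  case (Suc k)
  show ?case
    by (rule Ck_on_SucI[OF assms(1) has_derivative_add[OF
          Ck_on_Suc_has_derivative[OF Suc.prems(1)] Ck_on_Suc_has_derivative[OF Suc.prems(2)]]])
      (use Suc in auto)
qed

lemma Ck_on_sum:
  assumes "open S" "\<And>i. i \<in> I \<Longrightarrow> Ck_on k S (f i)"
  shows "Ck_on k S (\<lambda>x. \<Sum>i\<in>I. f i x)"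
  using assms(2)
  by (induction I rule: infinite_finite_induct) (auto intro: assms(1) Ck_on_const Ck_on_add)

lemma Ck_on_bilinear:
  assumes "bounded_bilinear B" "open S" "Ck_on k S f" "Ck_on k S g"
  shows "Ck_on k S (\<lambda>x. B (f x) (g x))"
  using assms(3,4)
proof (induction k arbitrary: f g)
  case 0
  then show ?case
    using bounded_bilinear.continuous_on[OF assms(1)] by simp
next
  case (Suc k)
  show ?case
  proof (rule Ck_on_SucI[OF assms(2) bounded_bilinear.FDERIV[OF assms(1)
          Ck_on_Suc_has_derivative[OF Suc.prems(1)] Ck_on_Suc_has_derivative[OF Suc.prems(2)]]])
    show "Ck_on k S (\<lambda>x. B (f x) (frechet_derivative g (at x) v)
        + B (frechet_derivative f (at x) v) (g x))" for v
      by (intro Ck_on_add assms(2) Suc.IH) (use Suc.prems Ck_on_SucD in \<open>auto\<close>)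
  qed
qed

text \<open>The chain rule expands the derivative of \<open>g \<circ> f\<close> in an orthonormal basis, which makes it a
  sum of products of maps to which the induction hypothesis applies.\<close>

lemma Ck_on_compose:
  assumes "open S" "open T" "f ` S \<subseteq> T" "Ck_on k T g" "Ck_on k S f"
  shows "Ck_on k S (\<lambda>x. g (f x))"
  using assms(4,5)
proof (induction k arbitrary: g)
  case 0
  then show ?case
    using assms(3) continuous_on_compose2 by auto
next
  case (Suc k)
  let ?G = "\<lambda>x. frechet_derivative g (at (f x))" and ?F = "\<lambda>x. frechet_derivative f (at x)"
  have "((\<lambda>x. g (f x)) has_derivative (\<lambda>v. \<Sum>b\<in>Basis. (?F x v \<bullet> b) *\<^sub>R ?G x b)) (at x)"
    if "x \<in> S" for x
  proof -
    have f: "(f has_derivative ?F x) (at x)"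
      using Ck_on_Suc_has_derivative[OF Suc.prems(2) that] .
    have g: "(g has_derivative ?G x) (at (f x))"
      using Ck_on_Suc_has_derivative[OF Suc.prems(1)] assms(3) that by blast
    have "?G x v = (\<Sum>b\<in>Basis. (v \<bullet> b) *\<^sub>R ?G x b)" for v
    proof -
      have "linear (?G x)"
        using g has_derivative_linear by blast
      then have "?G x (\<Sum>b\<in>Basis. (v \<bullet> b) *\<^sub>R b) = (\<Sum>b\<in>Basis. (v \<bullet> b) *\<^sub>R ?G x b)"
        by (simp add: linear_sum linear_cmul o_def)
      then show ?thesis by (simp add: euclidean_representation)
    qed
    then have "?G x (?F x v) = (\<Sum>b\<in>Basis. (?F x v \<bullet> b) *\<^sub>R ?G x b)" for v .
    then show ?thesis
      using diff_chain_at[OF f g] by (simp add: o_def)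
  qed
  moreover have "Ck_on k S (\<lambda>x. \<Sum>b\<in>Basis. (?F x v \<bullet> b) *\<^sub>R ?G x b)" for v
  proof (intro Ck_on_sum Ck_on_bilinear[OF bounded_bilinear_scaleR] assms(1))
    show "Ck_on k S (\<lambda>x. ?F x v \<bullet> b)" for b
      by (rule Ck_on_bounded_linear[OF bounded_linear_inner_left assms(1)])
        (use Suc.prems in simp)
    show "Ck_on k S (\<lambda>x. ?G x b)" for b
      by (rule Suc.IH) (use Suc.prems Ck_on_SucD in auto)
  qed
  ultimately show ?case
    by (rule Ck_on_SucI[OF assms(1)])
qed

lemma Ck_on_inverse:
  fixes f :: "'e::euclidean_space \<Rightarrow> complex"
  assumes "open S" "Ck_on k S f" "\<And>x. x \<in> S \<Longrightarrow> f x \<noteq> 0"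
  shows "Ck_on k S (\<lambda>x. inverse (f x))"
  using assms(2)
proof (induction k)
  case 0
  then show ?case
    using assms(3) by (simp add: continuous_on_inverse)
next
  case (Suc k)
  have "Ck_on k S (\<lambda>x. - (inverse (f x) * frechet_derivative f (at x) v * inverse (f x)))" for v
    by (rule Ck_on_bounded_linear[OF bounded_linear_minus[OF bounded_linear_ident] assms(1)])
      (intro Ck_on_bilinear[OF bounded_bilinear_mult assms(1)] Suc.IH,
        use Suc.prems Ck_on_SucD in auto)
  then show ?case
    by (intro Ck_on_SucI[OF assms(1) Deriv.has_derivative_inverse[OF assms(3)
          Ck_on_Suc_has_derivative[OF Suc.prems]]])
qed

lemma smooth_on_cong: "open S \<Longrightarrow> (\<And>x. x \<in> S \<Longrightarrow> f x = g x) \<Longrightarrow> smooth_on S f \<Longrightarrow> smooth_on S g"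
  unfolding smooth_on_def using Ck_on_cong by blast

lemma smooth_on_subset: "smooth_on S f \<Longrightarrow> T \<subseteq> S \<Longrightarrow> smooth_on T f"
  unfolding smooth_on_def using Ck_on_subset by blast

lemma smooth_on_local:
  "(\<And>x. x \<in> S \<Longrightarrow> \<exists>T. open T \<and> x \<in> T \<and> smooth_on T f) \<Longrightarrow> smooth_on S f"
  unfolding smooth_on_def by (meson Ck_on_local)

lemma smooth_on_const: "open S \<Longrightarrow> smooth_on S (\<lambda>x. c)"
  by (simp add: smooth_on_def Ck_on_const)

lemma smooth_on_ident: "open S \<Longrightarrow> smooth_on S (\<lambda>x. x)"
  by (simp add: smooth_on_def Ck_on_ident)

lemma smooth_on_add:
  "open S \<Longrightarrow> smooth_on S f \<Longrightarrow> smooth_on S g \<Longrightarrow> smooth_on S (\<lambda>x. f x + g x)"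
  by (simp add: smooth_on_def Ck_on_add)

lemma smooth_on_sum:
  "open S \<Longrightarrow> (\<And>i. i \<in> I \<Longrightarrow> smooth_on S (f i)) \<Longrightarrow> smooth_on S (\<lambda>x. \<Sum>i\<in>I. f i x)"
  by (simp add: smooth_on_def Ck_on_sum)

lemma smooth_on_bounded_linear:
  "bounded_linear L \<Longrightarrow> open S \<Longrightarrow> smooth_on S f \<Longrightarrow> smooth_on S (\<lambda>x. L (f x))"
  by (simp add: smooth_on_def Ck_on_bounded_linear)

lemma smooth_on_bilinear:
  "bounded_bilinear B \<Longrightarrow> open S \<Longrightarrow> smooth_on S f \<Longrightarrow> smooth_on S g \<Longrightarrow>
    smooth_on S (\<lambda>x. B (f x) (g x))"
  by (simp add: smooth_on_def Ck_on_bilinear)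

lemma smooth_on_compose:
  "open S \<Longrightarrow> open T \<Longrightarrow> f ` S \<subseteq> T \<Longrightarrow> smooth_on T g \<Longrightarrow> smooth_on S f \<Longrightarrow>
    smooth_on S (\<lambda>x. g (f x))"
  unfolding smooth_on_def using Ck_on_compose by blast

lemma smooth_on_inverse:
  fixes f :: "'e::euclidean_space \<Rightarrow> complex"
  shows "open S \<Longrightarrow> smooth_on S f \<Longrightarrow> (\<And>x. x \<in> S \<Longrightarrow> f x \<noteq> 0) \<Longrightarrow> smooth_on S (\<lambda>x. inverse (f x))"
  by (simp add: smooth_on_def Ck_on_inverse)

lemma smooth_on_mult:
  fixes f g :: "'e::euclidean_space \<Rightarrow> complex"
  shows "open S \<Longrightarrow> smooth_on S f \<Longrightarrow> smooth_on S g \<Longrightarrow> smooth_on S (\<lambda>x. f x * g x)"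
  by (rule smooth_on_bilinear[OF bounded_bilinear_mult])

lemma smooth_on_vec_nth:
  fixes f :: "'e::euclidean_space \<Rightarrow> complex ^ 'n"
  shows "open S \<Longrightarrow> smooth_on S f \<Longrightarrow> smooth_on S (\<lambda>x. f x $ k)"
  by (rule smooth_on_bounded_linear[OF bounded_linear_vec_nth])

lemma bounded_linear_axis: "bounded_linear (axis k :: complex \<Rightarrow> complex ^ 'n)"
  by (intro linear_conv_bounded_linear[THEN iffD1] linearI)
    (auto simp: axis_def vec_eq_iff)

lemma smooth_on_vec_lambda:
  fixes f :: "'n::finite \<Rightarrow> 'e::euclidean_space \<Rightarrow> complex"
  assumes "open S" "\<And>k. smooth_on S (f k)"
  shows "smooth_on S (\<lambda>x. \<chi> k. f k x)"
proof -
  have "(\<chi> k. f k x) = (\<Sum>k\<in>UNIV. axis k (f k x))" for x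
    by (auto simp: vec_eq_iff axis_def if_distrib cong: if_cong)
  then show ?thesis
    using assms by (simp add: smooth_on_sum smooth_on_bounded_linear[OF bounded_linear_axis])
qed

lemma smooth_on_imp_continuous_on: "smooth_on S f \<Longrightarrow> continuous_on S f"
  unfolding smooth_on_def by (metis Ck_on.simps(1))

lemma smooth_on_has_derivative:
  "smooth_on S f \<Longrightarrow> x \<in> S \<Longrightarrow> (f has_derivative frechet_derivative f (at x)) (at x)"
  unfolding smooth_on_def by (rule Ck_on_Suc_has_derivative) blast+

lemma smooth_on_frechet_derivative:
  "smooth_on S f \<Longrightarrow> smooth_on S (\<lambda>x. frechet_derivative f (at x) v)"
  unfolding smooth_on_def by (metis Ck_on.simps(2))

text \<open>A field of linear maps is only assumed to be smooth on each fixed vector. Expanding \<open>g x\<close> in a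
  basis shows that it is then smooth on a varying vector, too.\<close>

lemma smooth_on_linear_family:
  fixes K :: "'e::euclidean_space \<Rightarrow> 'f::euclidean_space \<Rightarrow> 'g::euclidean_space"
  assumes "open S" "\<And>x. x \<in> S \<Longrightarrow> linear (K x)" "\<And>v. smooth_on S (\<lambda>x. K x v)" "smooth_on S g"
  shows "smooth_on S (\<lambda>x. K x (g x))"
proof -
  have "K x (g x) = (\<Sum>b\<in>Basis. (g x \<bullet> b) *\<^sub>R K x b)" if "x \<in> S" for x
  proof -
    have "K x (\<Sum>b\<in>Basis. (g x \<bullet> b) *\<^sub>R b) = (\<Sum>b\<in>Basis. (g x \<bullet> b) *\<^sub>R K x b)"
      using assms(2)[OF that] by (simp add: linear_sum linear_cmul o_def)
    then show ?thesis by (simp add: euclidean_representation)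
  qed
  moreover have "smooth_on S (\<lambda>x. \<Sum>b\<in>Basis. (g x \<bullet> b) *\<^sub>R K x b)"
    using assms by (intro smooth_on_sum smooth_on_bilinear[OF bounded_bilinear_scaleR]
      smooth_on_bounded_linear[OF bounded_linear_inner_left]) auto
  ultimately show ?thesis
    using smooth_on_cong[OF assms(1)] by (metis (no_types, lifting))
qed

section \<open>Charts of the maximal atlas\<close>

text \<open>A chart is a pair, but quantifiers over charts must not be split into quantifiers over domains and
  maps: the facts below are stated for whole charts.\<close>

declare split_paired_All [simp del] split_paired_Ex [simp del]

abbreviation in_charts ::
  "('a, 'e::euclidean_space) chart \<Rightarrow> ('b, 'f::euclidean_space) chart \<Rightarrow> ('a \<Rightarrow> 'b) \<Rightarrow> 'e \<Rightarrow> 'f"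
  where "in_charts c d f \<equiv> (\<lambda>z. coord d (f (snd c z)))"

abbreviation d_in_charts ::
  "('a, 'e::euclidean_space) chart \<Rightarrow> ('b, 'f::euclidean_space) chart \<Rightarrow> ('a \<Rightarrow> 'b) \<Rightarrow> 'e \<Rightarrow> 'e \<Rightarrow> 'f"
  where "d_in_charts c d f q \<equiv> frechet_derivative (in_charts c d f) (at q)"

lemma coord_in: "p \<in> cimage c \<Longrightarrow> coord c p \<in> fst c"
  by (rule inv_into_into)

lemma snd_coord: "p \<in> cimage c \<Longrightarrow> snd c (coord c p) = p"
  by (rule f_inv_into_f)

lemma smooth_chart_inj: "smooth_chart M c \<Longrightarrow> inj_on (snd c) (fst c)"
  by (simp add: smooth_chart_def)

lemma smooth_chart_open: "smooth_chart M c \<Longrightarrow> open (fst c)"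
  by (simp add: smooth_chart_def)

lemma coord_snd: "smooth_chart M c \<Longrightarrow> z \<in> fst c \<Longrightarrow> coord c (snd c z) = z"
  by (simp add: smooth_chart_def)

lemma smooth_chart_subset: "smooth_chart M c \<Longrightarrow> cimage c \<subseteq> pts M"
  by (simp add: smooth_chart_def)

lemma atlas_smooth_chart: "smooth_manifold M \<Longrightarrow> c \<in> atlas M \<Longrightarrow> smooth_chart M c"
  by (simp add: smooth_manifold_def)

lemma atlas_covers:
  assumes "smooth_manifold M" "p \<in> pts M"
  obtains c where "c \<in> atlas M" "p \<in> cimage c"
  using assms unfolding smooth_manifold_def by blast

lemma smooth_on_compose_preimage:
  assumes "open S" "open T" "smooth_on S f" "smooth_on T g"
  shows "open {x \<in> S. f x \<in> T}" "smooth_on {x \<in> S. f x \<in> T} (\<lambda>x. g (f x))"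
proof -
  have "{x \<in> S. f x \<in> T} = S \<inter> f -` T"
    by auto
  with assms show *: "open {x \<in> S. f x \<in> T}"
    using continuous_on_open_vimage[OF assms(1)] smooth_on_imp_continuous_on
    by (metis Int_commute)
  show "smooth_on {x \<in> S. f x \<in> T} (\<lambda>x. g (f x))"
    by (rule smooth_on_compose[OF * assms(2) _ assms(4)])
      (auto intro: smooth_on_subset[OF assms(3)])
qed

lemma smooth_in_charts_open:
  "smooth_in_charts c d f \<Longrightarrow> open {z \<in> fst c. f (snd c z) \<in> cimage d}"
  by (simp add: smooth_in_charts_def Let_def)

lemma smooth_in_charts_smooth:
  "smooth_in_charts c d f \<Longrightarrow> smooth_on {z \<in> fst c. f (snd c z) \<in> cimage d} (in_charts c d f)"
  by (simp add: smooth_in_charts_def Let_def)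

text \<open>Around each point the expression of \<open>f\<close> in charts of the maximal atlases is the expression in
  charts of the given atlases, composed on both sides with transition maps.\<close>

lemma smooth_map_in_smooth_charts:
  assumes M: "smooth_manifold M" and N: "smooth_manifold N" and f: "smooth_map M N f"
    and c: "smooth_chart M c" and d: "smooth_chart N d"
  shows "smooth_in_charts c d f"
proof -
  let ?W = "{z \<in> fst c. f (snd c z) \<in> cimage d}"
  have *: "\<exists>V. open V \<and> z0 \<in> V \<and> V \<subseteq> ?W \<and> smooth_on V (in_charts c d f)" if z0: "z0 \<in> ?W" for z0
  proof -
    let ?p = "snd c z0"
    have "?p \<in> pts M" "f ?p \<in> pts N"
      using z0 smooth_chart_subset[OF c] smooth_chart_subset[OF d] by blast+
    then obtain c' d' where c': "c' \<in> atlas M" "?p \<in> cimage c'"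
      and d': "d' \<in> atlas N" "f ?p \<in> cimage d'"
      using atlas_covers M N by metis
    have 1: "smooth_in_charts c c' (\<lambda>p. p)"
      using c c'(1) by (auto simp: smooth_chart_def compatible_def)
    have 2: "smooth_in_charts c' d' f"
      using f c'(1) d'(1) by (auto simp: smooth_map_def)
    have 3: "smooth_in_charts d' d (\<lambda>p. p)"
      using d d'(1) by (auto simp: smooth_chart_def compatible_def)
    define A where "A = {z \<in> fst c. snd c z \<in> cimage c'}"
    define B where "B = {z \<in> fst c'. f (snd c' z) \<in> cimage d'}"
    define C where "C = {z \<in> fst d'. snd d' z \<in> cimage d}"
    define B' where "B' = {z \<in> B. in_charts c' d' f z \<in> C}"
    define V where "V = {z \<in> A. coord c' (snd c z) \<in> B'}"
    have oA: "open A" "smooth_on A (in_charts c c' (\<lambda>p. p))"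
      using smooth_in_charts_open[OF 1] smooth_in_charts_smooth[OF 1] by (auto simp: A_def)
    have oB: "open B" "smooth_on B (in_charts c' d' f)"
      using smooth_in_charts_open[OF 2] smooth_in_charts_smooth[OF 2] by (auto simp: B_def)
    have oC: "open C" "smooth_on C (in_charts d' d (\<lambda>p. p))"
      using smooth_in_charts_open[OF 3] smooth_in_charts_smooth[OF 3] by (auto simp: C_def)
    have oB': "open B'" "smooth_on B' (\<lambda>z. coord d (snd d' (coord d' (f (snd c' z)))))"
      unfolding B'_def using smooth_on_compose_preimage[OF oB(1) oC(1) oB(2) oC(2)] by auto
    have oV: "open V"
      "smooth_on V (\<lambda>z. coord d (snd d' (coord d' (f (snd c' (coord c' (snd c z)))))))"
      unfolding V_def using smooth_on_compose_preimage[OF oA(1) oB'(1) oA(2) oB'(2)] by auto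
    have "z0 \<in> V"
      using z0 c'(2) d'(2) coord_in[OF c'(2)] coord_in[OF d'(2)]
      by (simp add: V_def A_def B'_def B_def C_def snd_coord)
    moreover have V: "snd d' (coord d' (f (snd c' (coord c' (snd c z))))) = f (snd c z)"
      "z \<in> ?W" if "z \<in> V" for z
      using that unfolding V_def A_def B'_def B_def C_def mem_Collect_eq
      by (elim conjE, simp add: snd_coord)+
    ultimately show ?thesis
      using oV smooth_on_cong[OF oV(1) _ oV(2), of "in_charts c d f"]
      by (intro exI[of _ V]) auto
  qed
  have "open ?W"
    by (rule Topological_Spaces.openI) (use * in blast)
  moreover have "smooth_on ?W (in_charts c d f)"
    by (rule smooth_on_local) (use * in blast)
  ultimately show ?thesis
    by (simp add: smooth_in_charts_def)
qed

lemma smooth_map_ident: "smooth_manifold M \<Longrightarrow> smooth_map M M (\<lambda>p. p)"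
  by (auto simp: smooth_map_def smooth_manifold_def smooth_chart_def compatible_def)

lemma smooth_charts_compatible:
  assumes "smooth_manifold M" "smooth_chart M c" "smooth_chart M d"
  shows "smooth_in_charts c d (\<lambda>p. p)"
  using smooth_map_in_smooth_charts[OF assms(1) assms(1) smooth_map_ident] assms by blast

text \<open>The topology is defined by the given atlas. The charts of the maximal atlas are nevertheless
  homeomorphisms onto open sets: this lemma gives their continuity, the next one their openness.\<close>

lemma open_chart_preimage:
  assumes M: "smooth_manifold M" and c: "smooth_chart M c" and W: "openin (mfd_topology M) W"
  shows "open {z \<in> fst c. snd c z \<in> W}"
proof (rule Topological_Spaces.openI)
  fix z0 assume z0: "z0 \<in> {z \<in> fst c. snd c z \<in> W}"
  then obtain d where d: "d \<in> atlas M" "snd c z0 \<in> cimage d"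
    using atlas_covers[OF M] smooth_chart_subset[OF c] by blast
  have i: "smooth_in_charts c d (\<lambda>p. p)"
    using c d(1) by (auto simp: smooth_chart_def compatible_def)
  have o: "open {z \<in> fst d. snd d z \<in> W}"
    using W d(1) by (auto simp: openin_mfd_topology)
  let ?V = "{z \<in> {z \<in> fst c. snd c z \<in> cimage d}. coord d (snd c z) \<in> {z \<in> fst d. snd d z \<in> W}}"
  have "open ?V"
    by (rule smooth_on_compose_preimage(1)[OF smooth_in_charts_open[OF i] o
          smooth_in_charts_smooth[OF i] smooth_on_ident[OF o]])
  moreover have "z0 \<in> ?V" "?V \<subseteq> {z \<in> fst c. snd c z \<in> W}"
    using z0 d(2) coord_in[OF d(2)] by (auto simp: snd_coord)
  ultimately show "\<exists>T. open T \<and> z0 \<in> T \<and> T \<subseteq> {z \<in> fst c. snd c z \<in> W}"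
    by blast
qed

lemma openin_chart_image:
  assumes c: "smooth_chart M c" and V: "open V" "V \<subseteq> fst c"
  shows "openin (mfd_topology M) (snd c ` V)"
  unfolding openin_mfd_topology
proof (intro conjI ballI)
  show "snd c ` V \<subseteq> pts M"
    using smooth_chart_subset[OF c] V by blast
  fix d assume d: "d \<in> atlas M"
  then have i: "smooth_in_charts d c (\<lambda>p. p)"
    using c by (auto simp: smooth_chart_def compatible_def)
  have "{z \<in> fst d. snd d z \<in> snd c ` V} =
      {z \<in> {z \<in> fst d. snd d z \<in> cimage c}. coord c (snd d z) \<in> V}"
  proof -
    have "coord c (snd d z) \<in> V \<longleftrightarrow> snd d z \<in> snd c ` V" if "snd d z \<in> cimage c" for z
    proof
      assume "coord c (snd d z) \<in> V"
      then show "snd d z \<in> snd c ` V"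
        using snd_coord[OF that] by (rule rev_image_eqI[OF _ sym])
    next
      assume "snd d z \<in> snd c ` V"
      then obtain y where "y \<in> V" "snd d z = snd c y"
        by blast
      then show "coord c (snd d z) \<in> V"
        using V(2) coord_snd[OF c] by auto
    qed
    then show ?thesis
      using V by blast
  qed
  then show "open {z \<in> fst d. snd d z \<in> snd c ` V}"
    using smooth_on_compose_preimage(1)[OF smooth_in_charts_open[OF i] V(1)
          smooth_in_charts_smooth[OF i] smooth_on_ident[OF V(1)]] by simp
qed

lemma topspace_mfd_topology:
  assumes "smooth_manifold M"
  shows "topspace (mfd_topology M) = pts M"
proof -
  have "{z \<in> fst c. snd c z \<in> pts M} = fst c" if "c \<in> atlas M" for c
    using smooth_chart_subset[OF atlas_smooth_chart[OF assms that]] by auto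
  then have "openin (mfd_topology M) (pts M)"
    using assms by (auto simp: openin_mfd_topology smooth_manifold_def smooth_chart_def)
  then show ?thesis
    by (meson openin_mfd_topology openin_subset openin_topspace subset_antisym)
qed


section \<open>Tangent vectors in charts\<close>

lemma chart_atD: "chart_at M p c \<Longrightarrow> smooth_chart M c" "chart_at M p c \<Longrightarrow> p \<in> cimage c"
  by (simp_all add: chart_at_def)

lemma chart_at_snd: "smooth_chart M c \<Longrightarrow> q \<in> fst c \<Longrightarrow> chart_at M (snd c q) c"
  by (simp add: chart_at_def)

lemma chart_at_pts: "chart_at M p c \<Longrightarrow> p \<in> pts M"
  using smooth_chart_subset unfolding chart_at_def by blast

lemma chart_at_exists:
  assumes "smooth_manifold M" "p \<in> pts M"
  shows "\<exists>c. chart_at M p c"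
  using assms atlas_covers[OF assms] atlas_smooth_chart unfolding chart_at_def by metis

lemma has_derivative_in_charts:
  assumes "smooth_manifold M" "smooth_manifold N" "smooth_map M N f"
    and c: "chart_at M p c" and d: "chart_at N (f p) d"
  shows "(in_charts c d f has_derivative d_in_charts c d f (coord c p)) (at (coord c p))"
  using smooth_map_in_smooth_charts[OF assms(1-3) chart_atD(1)[OF c] chart_atD(1)[OF d]]
  by (rule smooth_on_has_derivative[OF smooth_in_charts_smooth])
    (use chart_atD(2)[OF c] chart_atD(2)[OF d] in \<open>simp add: snd_coord coord_in\<close>)

text \<open>The chain rule, from which all statements on independence of charts follow: with one of the maps
  the identity, it describes the effect of a change of charts.\<close>

lemma d_in_charts_compose:
  assumes M: "smooth_manifold M" and N: "smooth_manifold N" and P: "smooth_manifold P"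
    and f: "smooth_map M N f" and g: "smooth_map N P g"
    and c: "chart_at M p c" and d: "chart_at N (f p) d" and e: "chart_at P (g (f p)) e"
  shows "d_in_charts c e (\<lambda>p. g (f p)) (coord c p) v =
    d_in_charts d e g (coord d (f p)) (d_in_charts c d f (coord c p) v)"
proof -
  let ?W = "{z \<in> fst c. f (snd c z) \<in> cimage d}"
  have p: "snd c (coord c p) = p"
    using snd_coord[OF chart_atD(2)[OF c]] .
  have W: "open ?W"
    using smooth_in_charts_open
      smooth_map_in_smooth_charts[OF M N f chart_atD(1)[OF c] chart_atD(1)[OF d]] .
  have 1: "(in_charts c d f has_derivative d_in_charts c d f (coord c p)) (at (coord c p))"
    by (rule has_derivative_in_charts[OF M N f c d])
  have 2: "(in_charts d e g has_derivative d_in_charts d e g (coord d (f p)))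
      (at (in_charts c d f (coord c p)))"
    using has_derivative_in_charts[OF N P g d e] by (simp add: p)
  have "((\<lambda>z. coord e (g (f (snd c z)))) has_derivative
      (\<lambda>v. d_in_charts d e g (coord d (f p)) (d_in_charts c d f (coord c p) v))) (at (coord c p))"
    by (rule has_derivative_transform_within_open[OF diff_chain_at[OF 1 2, unfolded o_def] W])
      (use chart_atD(2)[OF c] chart_atD(2)[OF d] in \<open>auto simp: p coord_in snd_coord\<close>)
  from frechet_derivative_at[OF this] show ?thesis
    by (rule fun_cong[OF sym])
qed

lemma d_in_charts_ident:
  assumes c: "chart_at M p c"
  shows "d_in_charts c c (\<lambda>p. p) (coord c p) v = v"
proof -
  have "(in_charts c c (\<lambda>p. p) has_derivative (\<lambda>v. v)) (at (coord c p))"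
    by (rule has_derivative_transform_within_open[OF has_derivative_ident
          smooth_chart_open[OF chart_atD(1)[OF c]]])
      (use coord_snd[OF chart_atD(1)[OF c]] coord_in[OF chart_atD(2)[OF c]] in auto)
  from frechet_derivative_at[OF this] show ?thesis
    by metis
qed

lemma linear_d_in_charts:
  assumes "smooth_manifold M" "smooth_manifold N" "smooth_map M N f"
    and c: "chart_at M p c" and d: "chart_at N (f p) d"
  shows "linear (d_in_charts c d f (coord c p))"
  using has_derivative_in_charts[OF assms] has_derivative_linear by blast

lemmas d_transition_compose =
  d_in_charts_compose[where f = "\<lambda>p. p" and g = "\<lambda>p. p",
    OF _ _ _ smooth_map_ident smooth_map_ident]

lemma d_transition_inverse:
  assumes M: "smooth_manifold M" and c: "chart_at M p c" and d: "chart_at M p d"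
  shows "d_in_charts d c (\<lambda>p. p) (coord d p) (d_in_charts c d (\<lambda>p. p) (coord c p) v) = v"
  using d_transition_compose[OF M M M M M c d c, of v] d_in_charts_ident[OF c] by simp

lemma tangent_space_chart_at:
  "X \<in> tangent_space M p \<Longrightarrow> chart_at M p c \<Longrightarrow> chart_at M p d \<Longrightarrow>
    X d = d_in_charts c d (\<lambda>p. p) (coord c p) (X c)"
  unfolding tangent_space_def by blast

lemma tangent_space_outside: "X \<in> tangent_space M p \<Longrightarrow> \<not> chart_at M p c \<Longrightarrow> X c = 0"
  unfolding tangent_space_def by blast

lemma tangent_spaceI:
  assumes "\<And>c. \<not> chart_at M p c \<Longrightarrow> X c = 0"
    and "\<And>c d. chart_at M p c \<Longrightarrow> chart_at M p d \<Longrightarrow>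
      X d = d_in_charts c d (\<lambda>p. p) (coord c p) (X c)"
  shows "X \<in> tangent_space M p"
  using assms unfolding tangent_space_def by blast

lemma tangent_space_eqI:
  assumes "X \<in> tangent_space M p" "Y \<in> tangent_space M p" "chart_at M p c" "X c = Y c"
  shows "X = Y"
proof
  fix d
  show "X d = Y d"
  proof (cases "chart_at M p d")
    case True
    then show ?thesis
      using assms(4) tangent_space_chart_at[OF assms(1,3) True] tangent_space_chart_at[OF assms(2,3) True]
      by simp
  next
    case False
    then show ?thesis
      using tangent_space_outside[OF assms(1)] tangent_space_outside[OF assms(2)] by simp
  qed
qed

lemma dchart_apply:
  assumes "chart_at M p c" "chart_at M p d"
  shows "dchart M c (coord c p) v d = d_in_charts c d (\<lambda>p. p) (coord c p) v"
  using assms by (simp add: dchart_def snd_coord[OF chart_atD(2)])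

lemma dchart_self: "chart_at M p c \<Longrightarrow> dchart M c (coord c p) v c = v"
  by (simp add: dchart_apply d_in_charts_ident)

lemma dchart_in_tangent_space:
  assumes M: "smooth_manifold M" and c: "chart_at M p c"
  shows "dchart M c (coord c p) v \<in> tangent_space M p"
proof -
  have "dchart M c (coord c p) v d = 0" if "\<not> chart_at M p d" for d
    using that by (simp add: dchart_def snd_coord[OF chart_atD(2)[OF c]])
  moreover have "dchart M c (coord c p) v e =
      d_in_charts d e (\<lambda>p. p) (coord d p) (dchart M c (coord c p) v d)"
    if "chart_at M p d" "chart_at M p e" for d e
    using d_transition_compose[OF M M M M M c that] that by (simp add: dchart_apply[OF c])
  ultimately show ?thesis
    by (rule tangent_spaceI)
qed

lemma dchart_tangent:
  assumes "smooth_manifold M" "X \<in> tangent_space M p" "chart_at M p c"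
  shows "dchart M c (coord c p) (X c) = X"
  using assms by (intro tangent_space_eqI[OF dchart_in_tangent_space]) (auto simp: dchart_self)

text \<open>The tangent map may be computed in any pair of charts, although its definition fixes the chart
  of the source.\<close>

lemma tangent_map_apply:
  assumes M: "smooth_manifold M" and N: "smooth_manifold N" and f: "smooth_map M N f"
    and X: "X \<in> tangent_space M p" and c: "chart_at M p c" and d: "chart_at N (f p) d"
  shows "tangent_map M N f p X d = d_in_charts c d f (coord c p) (X c)"
proof -
  define e where "e = (SOME c. chart_at M p c)"
  have e: "chart_at M p e"
    unfolding e_def by (rule someI[of _ c]) (rule c)
  have "tangent_map M N f p X d = d_in_charts e d f (coord e p) (X e)"
    using d by (simp add: tangent_map_def e_def Let_def)
  also have "X e = d_in_charts c e (\<lambda>p. p) (coord c p) (X c)"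
    by (rule tangent_space_chart_at[OF X c e])
  also have "d_in_charts e d f (coord e p) \<dots> = d_in_charts c d f (coord c p) (X c)"
    using d_in_charts_compose[OF M M N smooth_map_ident[OF M] f c e d] by simp
  finally show ?thesis .
qed

lemma tangent_map_in_tangent_space:
  assumes M: "smooth_manifold M" and N: "smooth_manifold N" and f: "smooth_map M N f"
    and X: "X \<in> tangent_space M p" and p: "p \<in> pts M"
  shows "tangent_map M N f p X \<in> tangent_space N (f p)"
proof -
  obtain c where c: "chart_at M p c"
    using chart_at_exists[OF M p] by blast
  have "tangent_map M N f p X d = 0" if "\<not> chart_at N (f p) d" for d
    using that by (simp add: tangent_map_def Let_def)
  moreover have "tangent_map M N f p X e =
      d_in_charts d e (\<lambda>p. p) (coord d (f p)) (tangent_map M N f p X d)"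
    if d: "chart_at N (f p) d" and e: "chart_at N (f p) e" for d e
    unfolding tangent_map_apply[OF M N f X c d] tangent_map_apply[OF M N f X c e]
    using d_in_charts_compose[OF M N N f smooth_map_ident[OF N] c d e] by simp
  ultimately show ?thesis
    by (rule tangent_spaceI)
qed


section \<open>Almost complex structures in charts\<close>

lemma acs_in_tangent_space:
  "almost_complex_structure M J \<Longrightarrow> p \<in> pts M \<Longrightarrow> X \<in> tangent_space M p \<Longrightarrow> J p X \<in> tangent_space M p"
  by (auto simp: almost_complex_structure_def)

lemma acs_linear:
  assumes "almost_complex_structure M J" "p \<in> pts M" "X \<in> tangent_space M p" "Y \<in> tangent_space M p"
  shows "J p (\<lambda>c. a *\<^sub>R X c + b *\<^sub>R Y c) = (\<lambda>c. a *\<^sub>R J p X c + b *\<^sub>R J p Y c)"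
  using assms unfolding almost_complex_structure_def by blast

lemma acs_square:
  assumes "almost_complex_structure M J" "p \<in> pts M" "X \<in> tangent_space M p"
  shows "J p (J p X) = (\<lambda>c. - X c)"
  using assms unfolding almost_complex_structure_def by blast

text \<open>An almost complex structure acts on coordinate vectors by its expression in the chart; this and
  \<open>tangent_space_eqI\<close> reduce equations between tangent vectors to one chart.\<close>

lemma acs_apply:
  assumes "smooth_manifold M" "X \<in> tangent_space M p" "chart_at M p c"
  shows "J p X c = pullback_endo M J c (coord c p) (X c)"
  using assms by (simp add: pullback_endo_def snd_coord[OF chart_atD(2)] dchart_tangent)

lemma linear_pullback_endo:
  assumes M: "smooth_manifold M" and J: "almost_complex_structure M J" and c: "chart_at M p c"
  shows "linear (pullback_endo M J c (coord c p))"
proof -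
  let ?q = "coord c p"
  have lin: "linear (d_in_charts c d (\<lambda>p. p) ?q)" if "chart_at M p d" for d
    using linear_d_in_charts[OF M M smooth_map_ident[OF M] c that] .
  have *: "dchart M c ?q (a *\<^sub>R v + b *\<^sub>R w) = (\<lambda>d. a *\<^sub>R dchart M c ?q v d + b *\<^sub>R dchart M c ?q w d)"
    for a b v w
    by (rule ext) (simp add: dchart_def snd_coord[OF chart_atD(2)[OF c]] linear_add[OF lin] linear_cmul[OF lin])
  have "J p (dchart M c ?q (a *\<^sub>R v + b *\<^sub>R w)) c =
      a *\<^sub>R J p (dchart M c ?q v) c + b *\<^sub>R J p (dchart M c ?q w) c" for a b v w
    unfolding * acs_linear[OF J chart_at_pts[OF c] dchart_in_tangent_space[OF M c]
        dchart_in_tangent_space[OF M c]] ..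
  from this[of 1 _ 1] this[of _ _ 0 0] show ?thesis
    by (intro linearI)
      (simp_all add: pullback_endo_def snd_coord[OF chart_atD(2)[OF c]])
qed

lemma pullback_endo_square:
  assumes M: "smooth_manifold M" and J: "almost_complex_structure M J" and c: "chart_at M p c"
  shows "pullback_endo M J c (coord c p) (pullback_endo M J c (coord c p) v) = - v"
proof -
  let ?X = "dchart M c (coord c p) v"
  have X: "?X \<in> tangent_space M p" and p: "p \<in> pts M"
    using dchart_in_tangent_space[OF M c] chart_at_pts[OF c] by auto
  then have "J p (J p ?X) c = - v"
    using acs_square[OF J p X] dchart_self[OF c] by simp
  then show ?thesis
    using acs_apply[OF M X c] acs_apply[OF M acs_in_tangent_space[OF J p X] c] dchart_self[OF c]
    by simp
qed

lemma pullback_endo_transition: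
  assumes M: "smooth_manifold M" and J: "almost_complex_structure M J"
    and c: "chart_at M p c" and d: "chart_at M p d"
  shows "d_in_charts c d (\<lambda>p. p) (coord c p) (pullback_endo M J c (coord c p) v) =
    pullback_endo M J d (coord d p) (d_in_charts c d (\<lambda>p. p) (coord c p) v)"
proof -
  let ?X = "dchart M c (coord c p) v"
  have X: "?X \<in> tangent_space M p" and p: "p \<in> pts M"
    using dchart_in_tangent_space[OF M c] chart_at_pts[OF c] by auto
  show ?thesis
    using tangent_space_chart_at[OF acs_in_tangent_space[OF J p X] c d]
    by (simp add: acs_apply[OF M X c] acs_apply[OF M X d] dchart_self[OF c] dchart_apply[OF c d])
qed

text \<open>Smoothness is assumed in the charts of the atlas only. In another chart \<open>c\<close> of the maximal atlas
  the structure is locally conjugate, by a transition map, to the one in a chart of the atlas.\<close>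

lemma smooth_pullback_endo:
  assumes M: "smooth_manifold M" and J: "almost_complex_structure M J" and c: "smooth_chart M c"
  shows "smooth_on (fst c) (\<lambda>q. pullback_endo M J c q v)"
proof (rule smooth_on_local)
  fix q0 assume q0: "q0 \<in> fst c"
  then obtain d where d: "d \<in> atlas M" "snd c q0 \<in> cimage d"
    using atlas_covers[OF M] smooth_chart_subset[OF c] by blast
  have ds: "smooth_chart M d"
    using atlas_smooth_chart[OF M d(1)] .
  let ?T = "in_charts c d (\<lambda>p. p)" and ?S = "in_charts d c (\<lambda>p. p)"
  let ?DT = "d_in_charts c d (\<lambda>p. p)" and ?DS = "d_in_charts d c (\<lambda>p. p)"
  define W where "W = {z \<in> fst c. snd c z \<in> cimage d}"
  define W' where "W' = {z \<in> fst d. snd d z \<in> cimage c}"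
  have W: "open W" "smooth_on W ?T"
    using smooth_charts_compatible[OF M c ds] smooth_in_charts_open smooth_in_charts_smooth
    unfolding W_def by blast+
  have W': "open W'" "smooth_on W' ?S"
    using smooth_charts_compatible[OF M ds c] smooth_in_charts_open smooth_in_charts_smooth
    unfolding W'_def by blast+
  have TW: "?T ` W \<subseteq> W'"
    by (rule image_subsetI) (simp add: W_def W'_def coord_in snd_coord)
  have TWd: "?T ` W \<subseteq> fst d"
    using TW by (auto simp: W'_def)
  have at: "chart_at M (snd c q) c" "chart_at M (snd c q) d" "coord c (snd c q) = q" if "q \<in> W" for q
    using that c ds coord_snd[OF c] by (auto simp: W_def chart_at_def)
  have "pullback_endo M J c q v = ?DS (?T q) (pullback_endo M J d (?T q) (?DT q v))" if "q \<in> W" for q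
    using pullback_endo_transition[OF M J at(1,2)[OF that], of v] at(3)[OF that]
      d_transition_inverse[OF M at(1,2)[OF that], of "pullback_endo M J c q v"]
    by simp
  moreover have "smooth_on W (\<lambda>q. ?DS (?T q) (pullback_endo M J d (?T q) (?DT q v)))"
  proof (rule smooth_on_linear_family[OF W(1), where K = "\<lambda>q. ?DS (?T q)"])
    show "linear (?DS (?T q))" if "q \<in> W" for q
      using linear_d_in_charts[OF M M smooth_map_ident[OF M] at(2,1)[OF that]] .
    show "smooth_on W (\<lambda>q. ?DS (?T q) u)" for u
      using smooth_on_compose[OF W(1) W'(1) TW smooth_on_frechet_derivative[OF W'(2)] W(2)] .
    show "smooth_on W (\<lambda>q. pullback_endo M J d (?T q) (?DT q v))"
    proof (rule smooth_on_linear_family[OF W(1), where K = "\<lambda>q. pullback_endo M J d (?T q)"])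
      show "linear (pullback_endo M J d (?T q))" if "q \<in> W" for q
        using linear_pullback_endo[OF M J at(2)[OF that]] .
      show "smooth_on W (\<lambda>q. pullback_endo M J d (?T q) u)" for u
        by (rule smooth_on_compose[OF W(1) smooth_chart_open[OF ds] TWd _ W(2)])
          (use J d(1) in \<open>simp add: almost_complex_structure_def\<close>)
      show "smooth_on W (\<lambda>q. ?DT q v)"
        using smooth_on_frechet_derivative[OF W(2)] .
    qed
  qed
  ultimately have "smooth_on W (\<lambda>q. pullback_endo M J c q v)"
    using smooth_on_cong[OF W(1)] by (metis (no_types, lifting))
  then show "\<exists>T. open T \<and> q0 \<in> T \<and> smooth_on T (\<lambda>q. pullback_endo M J c q v)"
    using W(1) q0 d(2) by (auto simp: W_def)
qed

text \<open>The charts are indexed because \<open>K\<close> may depend on how a chart arises. The result does not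
  depend on the chosen index when the \<open>K i\<close> transform into each other (locale \<open>local_endos\<close>).\<close>

definition glued_endo ::
  "('a, 'e::euclidean_space) mfd \<Rightarrow> 'i set \<Rightarrow> ('i \<Rightarrow> ('a, 'e) chart) \<Rightarrow> ('i \<Rightarrow> 'e \<Rightarrow> 'e \<Rightarrow> 'e) \<Rightarrow>
     ('a, 'e) tangent_endo" where
  "glued_endo M I C K p X =
     (let i = (SOME i. i \<in> I \<and> p \<in> cimage (C i))
      in dchart M (C i) (coord (C i) p) (K i (coord (C i) p) (X (C i))))"

locale local_endos =
  fixes M :: "('a, 'e::euclidean_space) mfd" and I :: "'i set"
    and C :: "'i \<Rightarrow> ('a, 'e) chart" and K :: "'i \<Rightarrow> 'e \<Rightarrow> 'e \<Rightarrow> 'e"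
  assumes M: "smooth_manifold M" and atlas: "atlas M = C ` I"
    and transition: "\<And>i j p v. i \<in> I \<Longrightarrow> j \<in> I \<Longrightarrow> p \<in> cimage (C i) \<Longrightarrow> p \<in> cimage (C j) \<Longrightarrow>
      d_in_charts (C i) (C j) (\<lambda>p. p) (coord (C i) p) (K i (coord (C i) p) v) =
      K j (coord (C j) p) (d_in_charts (C i) (C j) (\<lambda>p. p) (coord (C i) p) v)"
begin

lemma chart_at_C: "i \<in> I \<Longrightarrow> p \<in> cimage (C i) \<Longrightarrow> chart_at M p (C i)"
  using atlas_smooth_chart[OF M] atlas by (auto simp: chart_at_def)

lemma glued_endo:
  assumes X: "X \<in> tangent_space M p" and p: "p \<in> pts M"
  shows "glued_endo M I C K p X \<in> tangent_space M p"
    and "j \<in> I \<Longrightarrow> p \<in> cimage (C j) \<Longrightarrow>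
      glued_endo M I C K p X (C j) = K j (coord (C j) p) (X (C j))"
proof -
  define i where "i = (SOME i. i \<in> I \<and> p \<in> cimage (C i))"
  have "\<exists>i. i \<in> I \<and> p \<in> cimage (C i)"
    using atlas_covers[OF M p] atlas by (metis imageE)
  then have i: "i \<in> I" "p \<in> cimage (C i)"
    using someI_ex[of "\<lambda>i. i \<in> I \<and> p \<in> cimage (C i)"] unfolding i_def by blast+
  have eq: "glued_endo M I C K p X = dchart M (C i) (coord (C i) p) (K i (coord (C i) p) (X (C i)))"
    by (simp add: glued_endo_def i_def Let_def)
  show "glued_endo M I C K p X \<in> tangent_space M p"
    unfolding eq by (rule dchart_in_tangent_space[OF M chart_at_C[OF i]])
  assume j: "j \<in> I" "p \<in> cimage (C j)"
  show "glued_endo M I C K p X (C j) = K j (coord (C j) p) (X (C j))"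
    unfolding eq dchart_apply[OF chart_at_C[OF i] chart_at_C[OF j]] transition[OF i(1) j(1) i(2) j(2)]
    using tangent_space_chart_at[OF X chart_at_C[OF i] chart_at_C[OF j]] by simp
qed

lemma pullback_glued_endo:
  assumes "i \<in> I" "q \<in> fst (C i)"
  shows "pullback_endo M (glued_endo M I C K) (C i) q v = K i q v"
proof -
  have p: "snd (C i) q \<in> cimage (C i)"
    using assms by simp
  note at = chart_at_C[OF assms(1) p]
  have q: "coord (C i) (snd (C i) q) = q"
    using coord_snd[OF chart_atD(1)[OF at] assms(2)] .
  show ?thesis
    using glued_endo(2)[OF dchart_in_tangent_space[OF M at] chart_at_pts[OF at] assms(1) p]
      dchart_self[OF at]
    by (simp add: pullback_endo_def q)
qed

lemma almost_complex_structure_glued_endo: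
  assumes lin: "\<And>i q. i \<in> I \<Longrightarrow> q \<in> fst (C i) \<Longrightarrow> linear (K i q)"
    and square: "\<And>i q v. i \<in> I \<Longrightarrow> q \<in> fst (C i) \<Longrightarrow> K i q (K i q v) = - v"
    and smooth: "\<And>i v. i \<in> I \<Longrightarrow> smooth_on (fst (C i)) (\<lambda>q. K i q v)"
  shows "almost_complex_structure M (glued_endo M I C K)"
  unfolding almost_complex_structure_def
proof (intro conjI ballI allI)
  fix p assume p: "p \<in> pts M"
  obtain i where i: "i \<in> I" "p \<in> cimage (C i)"
    using atlas_covers[OF M p] atlas by (metis imageE)
  let ?J = "glued_endo M I C K" and ?q = "coord (C i) p"
  note at = chart_at_C[OF i] and q = coord_in[OF i(2)]
  have comb: "(\<lambda>c. a *\<^sub>R X c + b *\<^sub>R Y c) \<in> tangent_space M p"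
    if X: "X \<in> tangent_space M p" and Y: "Y \<in> tangent_space M p" for X Y and a b :: real
  proof -
    have "a *\<^sub>R X d + b *\<^sub>R Y d =
        d_in_charts c d (\<lambda>p. p) (coord c p) (a *\<^sub>R X c + b *\<^sub>R Y c)"
      if c: "chart_at M p c" and d: "chart_at M p d" for c d
    proof -
      have l: "linear (d_in_charts c d (\<lambda>p. p) (coord c p))"
        using linear_d_in_charts[OF M M smooth_map_ident[OF M] c d] .
      show ?thesis
        using tangent_space_chart_at[OF X c d] tangent_space_chart_at[OF Y c d]
        by (simp add: linear_add[OF l] linear_cmul[OF l])
    qed
    moreover have "a *\<^sub>R X c + b *\<^sub>R Y c = 0" if "\<not> chart_at M p c" for c
      using tangent_space_outside[OF X that] tangent_space_outside[OF Y that] by simp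
    ultimately show ?thesis
      by (intro tangent_spaceI)
  qed
  show J: "?J p X \<in> tangent_space M p" if "X \<in> tangent_space M p" for X
    by (rule glued_endo(1)[OF that p])
  show "?J p (\<lambda>c. a *\<^sub>R X c + b *\<^sub>R Y c) = (\<lambda>c. a *\<^sub>R ?J p X c + b *\<^sub>R ?J p Y c)"
    if X: "X \<in> tangent_space M p" and Y: "Y \<in> tangent_space M p" for X Y and a b :: real
    by (rule tangent_space_eqI[OF J[OF comb[OF X Y]] comb[OF J[OF X] J[OF Y]] at])
      (simp add: glued_endo(2)[OF comb[OF X Y] p i] glued_endo(2)[OF X p i] glued_endo(2)[OF Y p i]
        linear_add[OF lin[OF i(1) q]] linear_cmul[OF lin[OF i(1) q]])
  show "?J p (?J p X) = (\<lambda>c. - X c)" if X: "X \<in> tangent_space M p" for X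
  proof (rule tangent_space_eqI[OF J[OF J[OF X]] _ at])
    show "(\<lambda>c. - X c) \<in> tangent_space M p"
      using comb[OF X X, of "-1" 0] by simp
    show "?J p (?J p X) (C i) = - X (C i)"
      by (simp add: glued_endo(2)[OF J[OF X] p i] glued_endo(2)[OF X p i] square[OF i(1) q])
  qed
next
  fix c v assume "c \<in> atlas M"
  then obtain i where i: "i \<in> I" "c = C i"
    using atlas by auto
  have "open (fst (C i))"
    using atlas_smooth_chart[OF M] atlas i(1) by (auto simp: smooth_chart_def)
  then show "smooth_on (fst c) (\<lambda>q. pullback_endo M (glued_endo M I C K) c q v)"
    unfolding i(2) by (rule smooth_on_cong[OF _ _ smooth[OF i(1)]])
      (simp add: pullback_glued_endo[OF i(1)])
qed

end

text \<open>Both sides of the defining equation are tangent vectors, so at each point they may be compared in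
  one pair of charts.\<close>

lemma pseudoholomorphicI:
  assumes M: "smooth_manifold M" and N: "smooth_manifold N"
    and J: "almost_complex_structure M J" and J': "almost_complex_structure N J'"
    and f: "smooth_map M N f"
    and eq: "\<And>p. p \<in> pts M \<Longrightarrow> \<exists>c d. chart_at M p c \<and> chart_at N (f p) d \<and>
      (\<forall>v. pullback_endo N J' d (coord d (f p)) (d_in_charts c d f (coord c p) v) =
           d_in_charts c d f (coord c p) (pullback_endo M J c (coord c p) v))"
  shows "pseudoholomorphic M J N J' f"
  unfolding pseudoholomorphic_def
proof (intro conjI f ballI)
  fix p X assume p: "p \<in> pts M" and X: "X \<in> tangent_space M p"
  obtain c d where c: "chart_at M p c" and d: "chart_at N (f p) d"
    and *: "\<And>v. pullback_endo N J' d (coord d (f p)) (d_in_charts c d f (coord c p) v) =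
           d_in_charts c d f (coord c p) (pullback_endo M J c (coord c p) v)"
    using eq[OF p] by blast
  have fp: "f p \<in> pts N"
    using chart_at_pts[OF d] .
  have T: "tangent_map M N f p Y \<in> tangent_space N (f p)" if "Y \<in> tangent_space M p" for Y
    using tangent_map_in_tangent_space[OF M N f that p] .
  note JX = acs_in_tangent_space[OF J p X]
  show "J' (f p) (tangent_map M N f p X) = tangent_map M N f p (J p X)"
    by (rule tangent_space_eqI[OF acs_in_tangent_space[OF J' fp T[OF X]] T[OF JX] d])
      (simp add: acs_apply[OF N T[OF X] d] tangent_map_apply[OF M N f X c d]
        tangent_map_apply[OF M N f JX c d] acs_apply[OF M X c] *)
qed

section \<open>The affine charts of the blow-up model\<close>

abbreviation affine_point :: "'n \<Rightarrow> complex ^ 'n \<Rightarrow> complex ^ 'n" where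
  "affine_point i w \<equiv> w $ i *s affine_vec i w"

definition d_affine_point :: "'n \<Rightarrow> complex ^ 'n \<Rightarrow> complex ^ 'n \<Rightarrow> complex ^ 'n" where
  "d_affine_point i w h = (\<chi> k. if k = i then h $ i else h $ i * w $ k + w $ i * h $ k)"

text \<open>The coordinates of the point \<open>(z, [v])\<close> of the model in the \<open>i\<close>-th affine chart.\<close>

definition affine_coord :: "'n \<Rightarrow> complex ^ 'n \<Rightarrow> complex ^ 'n \<Rightarrow> complex ^ 'n" where
  "affine_coord i z v = (\<chi> k. if k = i then z $ i else v $ k / v $ i)"

lemma affine_vec_nth [simp]: "affine_vec i w $ i = 1"
  by (simp add: affine_vec_def)

lemma affine_vec_nonzero [simp]: "affine_vec i w \<noteq> 0"
  by (metis affine_vec_nth zero_index zero_neq_one)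

lemma affine_point_eq_0 [simp]: "affine_point i w = 0 \<longleftrightarrow> w $ i = 0"
  by (simp add: vector_mul_eq_0)

lemma proj_point_eq_iff:
  assumes "v \<noteq> 0" "u \<noteq> 0"
  shows "proj_point u = proj_point v \<longleftrightarrow> (\<exists>a. a \<noteq> 0 \<and> u = a *s v)"
proof
  assume "proj_point u = proj_point v"
  then have "u \<in> vec.span {v}"
    unfolding proj_point_def using vec.span_base[of u "{u}"] by simp
  then obtain a where "u = a *s v"
    by (auto simp: vec.span_singleton)
  with assms show "\<exists>a. a \<noteq> 0 \<and> u = a *s v"
    by auto
next
  assume "\<exists>a. a \<noteq> 0 \<and> u = a *s v"
  then obtain a where a: "a \<noteq> 0" "u = a *s v"
    by auto
  then have "v = inverse a *s u"
    by (simp add: vector_smult_assoc)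
  then show "proj_point u = proj_point v"
    unfolding proj_point_def using a
    by (intro vec.span_eq[THEN iffD2])
      (metis empty_subsetI insert_subset vec.span_base vec.span_scale singletonI)
qed

lemma minors_eq_0_iff:
  assumes "v \<noteq> (0 :: complex ^ 'n)"
  shows "(\<forall>j k. z $ j * v $ k - z $ k * v $ j = 0) \<longleftrightarrow> (\<exists>a. z = a *s v)"
proof
  assume eq: "\<forall>j k. z $ j * v $ k - z $ k * v $ j = 0"
  from assms obtain i where i: "v $ i \<noteq> 0"
    by (auto simp: vec_eq_iff)
  have "((z $ i / v $ i) *s v) $ k = z $ k" for k
    using eq[rule_format, of i k] i by (simp add: field_simps)
  then have "z = (z $ i / v $ i) *s v"
    unfolding vec_eq_iff by metis
  then show "\<exists>a. z = a *s v"
    by blast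
qed auto

lemma mem_blowup_model:
  assumes "v \<noteq> (0 :: complex ^ 'n)"
  shows "(z, proj_point v) \<in> blowup_model U \<longleftrightarrow> z \<in> U \<and> (\<exists>a. z = a *s v)"
proof -
  have "(z, proj_point v) \<in> blowup_model U \<longleftrightarrow>
      z \<in> U \<and> (\<exists>u. proj_point u = proj_point v \<and> u \<noteq> 0 \<and> (\<exists>a. z = a *s u))"
    (is "_ \<longleftrightarrow> _ \<and> (\<exists>u. ?P u)")
  proof -
    have "(z, proj_point v) \<in> blowup_model U \<longleftrightarrow> z \<in> U \<and> (\<exists>u. proj_point u = proj_point v \<and> u \<noteq> 0 \<and>
        (\<forall>j k. z $ j * u $ k - z $ k * u $ j = 0))"
      unfolding blowup_model_def mem_Collect_eq prod.inject by metis
    also have "\<dots> \<longleftrightarrow> z \<in> U \<and> (\<exists>u. ?P u)"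
      by (rule conj_cong refl ex_cong1 minors_eq_0_iff | assumption)+
    finally show ?thesis .
  qed
  also have "(\<exists>u. proj_point u = proj_point v \<and> u \<noteq> 0 \<and> (\<exists>a. z = a *s u)) \<longleftrightarrow> (\<exists>a. z = a *s v)"
    using assms by (auto simp: proj_point_eq_iff vector_smult_assoc)
  finally show ?thesis .
qed

lemma blowup_model_cases:
  assumes "p \<in> blowup_model U"
  obtains a v where "v \<noteq> 0" "a *s v \<in> U" "p = (a *s v, proj_point v)"
proof -
  from assms obtain z v where "p = (z, proj_point v)" "v \<noteq> 0"
    unfolding blowup_model_def by blast
  then show thesis
    using assms mem_blowup_model[of v z U] that[of v] by auto
qed

lemma blowup_model_nonzero:
  assumes "(z, L) \<in> blowup_model U" "z \<noteq> 0"
  shows "L = proj_point z"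
proof -
  from assms(1) obtain a v where *: "v \<noteq> 0" "z = a *s v" "L = proj_point v"
    by (elim blowup_model_cases) auto
  moreover have "proj_point z = proj_point v"
    using * assms(2) by (subst proj_point_eq_iff) auto
  ultimately show ?thesis
    by simp
qed

lemma nonzero_in_blowup_model: "z \<in> U \<Longrightarrow> z \<noteq> 0 \<Longrightarrow> (z, proj_point z) \<in> blowup_model U"
  using mem_blowup_model[of z z U] vector_smult_lid[of z] by metis

lemma affine_coord_scale: "a \<noteq> 0 \<Longrightarrow> affine_coord i z (a *s v) = affine_coord i z v"
  by (simp add: affine_coord_def vec_eq_iff)

lemma affine_coord_affine_chart:
  "affine_coord i (affine_point i w) (affine_vec i w) = w"
  by (simp add: affine_coord_def vec_eq_iff) (simp add: affine_vec_def)

lemma affine_vec_affine_coord: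
  "v $ i \<noteq> 0 \<Longrightarrow> affine_vec i (affine_coord i z v) = inverse (v $ i) *s v"
  by (simp add: affine_vec_def affine_coord_def vec_eq_iff field_simps)

lemma affine_point_affine_coord:
  assumes "v $ i \<noteq> 0"
  shows "affine_point i (affine_coord i (a *s v) v) = a *s v"
  using assms by (simp add: affine_vec_affine_coord vec_eq_iff) (simp add: affine_coord_def)

lemma affine_chart_affine_coord:
  assumes "v $ i \<noteq> 0"
  shows "snd (affine_chart U i) (affine_coord i (a *s v) v) = (a *s v, proj_point v)"
proof -
  have "v \<noteq> 0"
    using assms by auto
  then have "proj_point (inverse (v $ i) *s v) = proj_point v"
    using assms by (subst proj_point_eq_iff) (auto simp: vector_mul_eq_0)
  then show ?thesis
    using affine_point_affine_coord[OF assms, of a] assms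
    by (simp add: affine_chart_def affine_vec_affine_coord)
qed

lemma fst_affine_chart: "fst (affine_chart U i) = {w. affine_point i w \<in> U}"
  by (simp add: affine_chart_def)

lemma snd_affine_chart: "snd (affine_chart U i) w = (affine_point i w, proj_point (affine_vec i w))"
  by (simp add: affine_chart_def)

lemma affine_chart_eqD:
  assumes "v \<noteq> 0" "snd (affine_chart U i) w = (z, proj_point v)"
  shows "v $ i \<noteq> 0" "w = affine_coord i z v"
proof -
  from assms obtain a where a: "a \<noteq> 0" "affine_vec i w = a *s v" and z: "z = affine_point i w"
    by (auto simp: snd_affine_chart proj_point_eq_iff)
  have "a * v $ i = 1"
    using arg_cong[OF a(2), of "\<lambda>u. u $ i"] by simp
  then show "v $ i \<noteq> 0"
    by auto
  show "w = affine_coord i z v"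
  proof -
    have "affine_coord i z (affine_vec i w) = w"
      by (simp only: z affine_coord_affine_chart)
    then show ?thesis
      by (simp add: a affine_coord_scale)
  qed
qed

lemma affine_chart_in_model:
  "affine_point i w \<in> U \<Longrightarrow> snd (affine_chart U i) w \<in> blowup_model U"
  by (auto simp: snd_affine_chart mem_blowup_model)

lemma inj_affine_chart: "inj (snd (affine_chart U i))"
proof (rule injI)
  fix w w' assume "snd (affine_chart U i) w = snd (affine_chart U i) w'"
  then have "w = affine_coord i (affine_point i w') (affine_vec i w')"
    by (intro affine_chart_eqD(2)) (simp_all add: snd_affine_chart)
  then show "w = w'"
    by (simp only: affine_coord_affine_chart)
qed

subsection \<open>Smoothness of the coordinate changes of the model\<close>

lemma smooth_affine_vec: "open S \<Longrightarrow> smooth_on S (affine_vec i)"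
  unfolding affine_vec_def
proof (rule smooth_on_vec_lambda)
  fix k assume "open S"
  then show "smooth_on S (\<lambda>w. if k = i then 1 else w $ k)"
    by (cases "k = i") (auto intro: smooth_on_const smooth_on_vec_nth smooth_on_ident)
qed

lemma smooth_affine_point: "open S \<Longrightarrow> smooth_on S (affine_point i)"
proof -
  assume S: "open S"
  have "smooth_on S (\<lambda>w. \<chi> k. w $ i * affine_vec i w $ k)"
    by (intro smooth_on_vec_lambda smooth_on_mult smooth_on_vec_nth smooth_on_ident
        smooth_affine_vec S)
  then show ?thesis
    by (simp add: vector_scalar_mult_def)
qed

lemma open_affine_preimage:
  assumes "open V"
  shows "open {w. affine_point i w \<in> V}"
  using smooth_on_compose_preimage(1)[OF open_UNIV assms smooth_affine_point[OF open_UNIV]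
      smooth_on_ident[OF assms], of i] by simp

lemma open_affine_vec_preimage:
  assumes "open V"
  shows "open {w. affine_vec i w \<in> V}"
  using smooth_on_compose_preimage(1)[OF open_UNIV assms smooth_affine_vec[OF open_UNIV]
      smooth_on_ident[OF assms], of i] by simp

lemma smooth_affine_coord:
  assumes "open S" "smooth_on S z" "smooth_on S v" "\<And>x. x \<in> S \<Longrightarrow> v x $ i \<noteq> 0"
  shows "smooth_on S (\<lambda>x. affine_coord i (z x) (v x))"
  unfolding affine_coord_def
proof (rule smooth_on_vec_lambda[OF assms(1)])
  fix k
  show "smooth_on S (\<lambda>x. if k = i then z x $ i else v x $ k / v x $ i)"
    using assms by (cases "k = i")
      (auto simp: divide_inverse intro!: smooth_on_mult smooth_on_inverse smooth_on_vec_nth)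
qed

lemma has_derivative_vec:
  fixes f :: "'e::euclidean_space \<Rightarrow> complex ^ 'n"
  assumes "\<And>k. ((\<lambda>x. f x $ k) has_derivative (\<lambda>h. f' h $ k)) (at x)"
  shows "(f has_derivative f') (at x)"
proof -
  have *: "y = (\<Sum>k\<in>UNIV. axis k (y $ k))" for y :: "complex ^ 'n"
    by (auto simp: vec_eq_iff axis_def if_distrib cong: if_cong)
  have "((\<lambda>x. \<Sum>k\<in>UNIV. axis k (f x $ k)) has_derivative (\<lambda>h. \<Sum>k\<in>UNIV. axis k (f' h $ k))) (at x)"
    by (intro has_derivative_sum bounded_linear.has_derivative[OF bounded_linear_axis] assms)
  then show ?thesis
    by (simp flip: *)
qed

lemma has_derivative_affine_point: "(affine_point i has_derivative d_affine_point i w) (at w)"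
proof (rule has_derivative_vec)
  have nth: "((\<lambda>w. w $ k) has_derivative (\<lambda>h. h $ k)) (at w)" for k
    by (rule bounded_linear.has_derivative[OF bounded_linear_vec_nth has_derivative_ident])
  fix k
  show "((\<lambda>w. affine_point i w $ k) has_derivative (\<lambda>h. d_affine_point i w h $ k)) (at w)"
    using nth has_derivative_mult[OF nth[of i] nth[of k]]
    by (cases "k = i") (simp_all add: affine_vec_def d_affine_point_def add.commute)
qed

lemma linear_d_affine_point: "linear (d_affine_point i w)"
  using has_derivative_linear[OF has_derivative_affine_point] .

lemma d_affine_point_scale: "d_affine_point i w (a *s h) = a *s d_affine_point i w h"
  by (simp add: d_affine_point_def vec_eq_iff algebra_simps)

lemma d_affine_point_axis: "d_affine_point i w (axis i a) = a *s affine_vec i w"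
  by (simp add: d_affine_point_def affine_vec_def axis_def vec_eq_iff)

lemma inj_d_affine_point:
  assumes "w $ i \<noteq> 0"
  shows "inj (d_affine_point i w)"
proof (rule injI)
  fix g h assume eq: "d_affine_point i w g = d_affine_point i w h"
  have "g $ i = h $ i"
    using arg_cong[OF eq, of "\<lambda>y. y $ i"] by (simp add: d_affine_point_def)
  moreover have "g $ k = h $ k" if "k \<noteq> i" for k
    using arg_cong[OF eq, of "\<lambda>y. y $ k"] that \<open>g $ i = h $ i\<close> assms
    by (simp add: d_affine_point_def)
  ultimately show "g = h"
    by (metis vec_eq_iff)
qed

lemma smooth_d_affine_point: "open S \<Longrightarrow> smooth_on S (\<lambda>w. d_affine_point i w h)"
  unfolding d_affine_point_def
proof (rule smooth_on_vec_lambda)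
  fix k assume "open S"
  then show "smooth_on S (\<lambda>w. if k = i then h $ i else h $ i * w $ k + w $ i * h $ k)"
    by (cases "k = i")
      (auto intro!: smooth_on_const smooth_on_add smooth_on_mult smooth_on_vec_nth smooth_on_ident)
qed

text \<open>The change of affine coordinates is a rational map, so its derivative is complex linear. On the
  exceptional divisor, where the differential of the projection need not be injective, this is what
  makes the lifted structures in two affine charts agree.\<close>

lemma affine_transition_derivative:
  assumes "affine_vec i w $ j \<noteq> 0"
  shows "\<exists>T'. ((\<lambda>w. affine_coord j (affine_point i w) (affine_vec i w)) has_derivative T') (at w) \<and>
    (\<forall>h. T' (\<i> *s h) = \<i> *s T' h)"
proof -
  define V where "V k h = (if k = i then 0 else h $ k :: complex)" for k and h :: "complex ^ 'a"
  have V: "((\<lambda>w. affine_vec i w $ k) has_derivative V k) (at w)" for k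
    by (cases "k = i") (auto simp: affine_vec_def V_def[abs_def]
        intro!: bounded_linear.has_derivative[OF bounded_linear_vec_nth] derivative_eq_intros)
  have P: "((\<lambda>w. affine_point i w $ j) has_derivative (\<lambda>h. d_affine_point i w h $ j)) (at w)"
    by (rule bounded_linear.has_derivative[OF bounded_linear_vec_nth has_derivative_affine_point])
  define u where "u = affine_vec i w"
  define T' where "T' h = (\<chi> k. if k = j then d_affine_point i w h $ j
      else (V k h * u $ j - u $ k * V j h) / (u $ j * u $ j))" for h
  have "((\<lambda>w. affine_coord j (affine_point i w) (affine_vec i w)) has_derivative T') (at w)"
  proof (rule has_derivative_vec)
    fix k
    show "((\<lambda>w. affine_coord j (affine_point i w) (affine_vec i w) $ k)
        has_derivative (\<lambda>h. T' h $ k)) (at w)"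
    proof (cases "k = j")
      case True
      then show ?thesis
        using P by (simp add: affine_coord_def T'_def)
    next
      case False
      then show ?thesis
        using has_derivative_divide'[OF V[of k] V[of j] assms]
        by (simp add: affine_coord_def T'_def u_def)
    qed
  qed
  moreover have "T' (\<i> *s h) = \<i> *s T' h" for h
    by (auto simp: T'_def V_def d_affine_point_scale vec_eq_iff)
      (auto simp: algebra_simps divide_inverse)
  ultimately show ?thesis
    by blast
qed


section \<open>Lifting a structure that satisfies the line condition\<close>

text \<open>Where \<open>w $ i \<noteq> 0\<close>, the structure on the blow-up must be \<open>J\<close> conjugated by the differential
  of \<open>affine_point i\<close>. By the line condition the defect \<open>J y - \<i> y\<close> is a multiple of
  \<open>affine_point i w\<close>, hence the image under the differential of a vector on the \<open>i\<close>-th axis, and this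
  vector has the same \<open>i\<close>-th component as the defect. So the conjugate differs from
  multiplication with \<open>\<i>\<close> by the second summand below, which involves no division and makes sense
  on the exceptional divisor \<open>w $ i = 0\<close>.\<close>

definition lifted_endo ::
  "(complex ^ 'n \<Rightarrow> complex ^ 'n \<Rightarrow> complex ^ 'n) \<Rightarrow> 'n \<Rightarrow> complex ^ 'n \<Rightarrow> complex ^ 'n \<Rightarrow> complex ^ 'n"
  where "lifted_endo J i w h =
    \<i> *s h + axis i ((J (affine_point i w) (d_affine_point i w h) - \<i> *s d_affine_point i w h) $ i)"

text \<open>If the defect is \<open>a *s affine_point i w\<close>, then its \<open>i\<close>-th component is \<open>a * w $ i\<close>, and the
  differential maps \<open>axis i (a * w $ i)\<close> back to the defect. This needs no inverse of the differential
  and so holds on the exceptional divisor, too.\<close>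

lemma lifted_endo_intertwines:
  assumes "\<And>y. J (affine_point i w) y - \<i> *s y \<in> vec.span {affine_point i w}"
  shows "d_affine_point i w (lifted_endo J i w h) = J (affine_point i w) (d_affine_point i w h)"
proof -
  let ?y = "d_affine_point i w h"
  from assms[of ?y] obtain a where "J (affine_point i w) ?y - \<i> *s ?y = a *s affine_point i w"
    by (auto simp: vec.span_singleton)
  then have "J (affine_point i w) ?y = \<i> *s ?y + a *s affine_point i w"
    by (simp add: algebra_simps)
  then show ?thesis
    by (simp add: lifted_endo_def linear_add[OF linear_d_affine_point] d_affine_point_scale
        d_affine_point_axis vector_smult_assoc)
qed

lemma lifted_endo_exceptional:
  assumes "\<And>y. J (affine_point i w) y - \<i> *s y \<in> vec.span {affine_point i w}" "w $ i = 0"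
  shows "lifted_endo J i w h = \<i> *s h"
proof -
  have "J 0 y - \<i> *s y = 0" for y
    using assms(1)[of y] assms(2) by (simp add: vec.span_singleton)
  then show ?thesis
    using assms(2) by (simp add: lifted_endo_def)
qed

lemma linear_imaginary_unit_scale: "linear (\<lambda>h :: complex ^ 'n. \<i> *s h)"
  by (intro linearI) (simp_all add: vec_eq_iff algebra_simps)

lemma linear_lifted_endo:
  assumes "linear (J (affine_point i w))"
  shows "linear (lifted_endo J i w)"
proof -
  have "linear (\<lambda>h. J (affine_point i w) (d_affine_point i w h))"
    using linear_compose[OF linear_d_affine_point assms] by (simp add: o_def)
  moreover have "linear (\<lambda>h. \<i> *s d_affine_point i w h)"
    using linear_compose[OF linear_d_affine_point linear_imaginary_unit_scale] by (simp add: o_def)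
  ultimately have diff:
    "linear (\<lambda>h. J (affine_point i w) (d_affine_point i w h) - \<i> *s d_affine_point i w h)"
    by (rule linear_compose_sub)
  have "linear (\<lambda>h. axis i ((J (affine_point i w) (d_affine_point i w h)
      - \<i> *s d_affine_point i w h) $ i) :: complex ^ 'a)"
    using linear_compose[OF linear_compose[OF diff bounded_linear.linear[OF bounded_linear_vec_nth]]
      bounded_linear.linear[OF bounded_linear_axis]] by (simp only: o_def)
  then show ?thesis
    unfolding lifted_endo_def[abs_def] by (intro linear_compose_add linear_imaginary_unit_scale)
qed

text \<open>Off the exceptional divisor the equation is carried over from \<open>J\<close> by the injective differential; on
  it the lifted structure is multiplication with \<open>\<i>\<close>.\<close>

lemma lifted_endo_square:
  assumes line: "\<And>y. J (affine_point i w) y - \<i> *s y \<in> vec.span {affine_point i w}"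
    and square: "\<And>y. J (affine_point i w) (J (affine_point i w) y) = - y"
  shows "lifted_endo J i w (lifted_endo J i w h) = - h"
proof (cases "w $ i = 0")
  case True
  then show ?thesis
    using lifted_endo_exceptional[where J = J, OF line] by (simp add: vec_eq_iff)
next
  case False
  have "d_affine_point i w (lifted_endo J i w (lifted_endo J i w h)) = d_affine_point i w (- h)"
    using lifted_endo_intertwines[where J = J, OF line] square
    by (simp add: linear_neg[OF linear_d_affine_point])
  then show ?thesis
    using inj_d_affine_point[OF False] by (simp add: inj_def)
qed

lemma smooth_lifted_endo:
  fixes J :: "complex ^ 'n \<Rightarrow> complex ^ 'n \<Rightarrow> complex ^ 'n"
  assumes U: "open U" and lin: "\<And>q. q \<in> U \<Longrightarrow> linear (J q)" and J: "\<And>v. smooth_on U (\<lambda>q. J q v)"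
  shows "smooth_on {w. affine_point i w \<in> U} (\<lambda>w. lifted_endo J i w h)"
proof -
  let ?S = "{w. affine_point i w \<in> U}"
  have S: "open ?S"
    by (rule open_affine_preimage[OF U])
  have "smooth_on ?S (\<lambda>w. J (affine_point i w) v)" for v
    by (rule smooth_on_compose[OF S U _ J smooth_affine_point[OF S]]) auto
  then have 1: "smooth_on ?S (\<lambda>w. J (affine_point i w) (d_affine_point i w h))"
    using lin by (intro smooth_on_linear_family[OF S _ _ smooth_d_affine_point[OF S],
          where K = "\<lambda>w. J (affine_point i w)"]) auto
  have 2: "smooth_on ?S (\<lambda>w. - (\<i> *s d_affine_point i w h))"
    by (rule smooth_on_bounded_linear[OF _ S smooth_d_affine_point[OF S], where L = "\<lambda>h. - (\<i> *s h)"])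
      (rule linear_compose_neg[OF linear_imaginary_unit_scale, unfolded linear_conv_bounded_linear])
  show ?thesis
    unfolding lifted_endo_def diff_conv_add_uminus
    by (intro smooth_on_add smooth_on_const smooth_on_vec_nth 1 2 S
        smooth_on_bounded_linear[OF bounded_linear_axis])
qed

section \<open>The blow-up is a smooth manifold\<close>

text \<open>Coordinates are inverse images under charts, so they are not computed directly: a candidate \<open>g\<close>
  for the coordinate expression is verified by applying the injective target chart to it.\<close>

lemma smooth_in_chartsI:
  assumes "open W" "smooth_on W g" "inj_on (snd d) (fst d)"
    and W: "\<And>z. z \<in> fst c \<Longrightarrow> f (snd c z) \<in> cimage d \<longleftrightarrow> z \<in> W" "W \<subseteq> fst c"
    and g: "\<And>z. z \<in> W \<Longrightarrow> g z \<in> fst d" "\<And>z. z \<in> W \<Longrightarrow> f (snd c z) = snd d (g z)"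
  shows "smooth_in_charts c d f" "\<And>z. z \<in> W \<Longrightarrow> in_charts c d f z = g z"
proof -
  show *: "in_charts c d f z = g z" if "z \<in> W" for z
    using g[OF that] assms(3) by simp
  have "{z \<in> fst c. f (snd c z) \<in> cimage d} = W"
    using W by blast
  moreover have "smooth_on W (in_charts c d f)"
    by (rule smooth_on_cong[OF assms(1) _ assms(2)]) (simp add: *)
  ultimately show "smooth_in_charts c d f"
    using assms(1) by (simp add: smooth_in_charts_def)
qed

locale blowup_at =
  fixes M :: "('a, complex ^ 'n) mfd" and x :: 'a and c :: "('a, complex ^ 'n) chart"
  assumes M: "smooth_manifold M" and origin: "smooth_local_chart_at_origin M x c"
begin

abbreviation "U \<equiv> fst c"
abbreviation "\<phi> \<equiv> snd c"
abbreviation "Bl \<equiv> blowup M x c"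
abbreviation "old_pt y \<equiv> blowup_class M x c (Inl y)"
abbreviation "model_pt p \<equiv> blowup_class M x c (Inr p)"

definition old_chart :: "('a, complex ^ 'n) chart \<Rightarrow> (('a, 'n) blowup_pre set, complex ^ 'n) chart" where
  "old_chart d = ({z \<in> fst d. snd d z \<noteq> x}, \<lambda>z. old_pt (snd d z))"

definition new_chart :: "'n \<Rightarrow> (('a, 'n) blowup_pre set, complex ^ 'n) chart" where
  "new_chart i = ({w. affine_point i w \<in> U}, \<lambda>w. model_pt (snd (affine_chart U i) w))"

lemma centre_chart: "smooth_chart M c" "0 \<in> U" "\<phi> 0 = x"
  using origin by (simp_all add: smooth_local_chart_at_origin_def)

lemma open_U: "open U"
  using centre_chart(1) by (rule smooth_chart_open)

lemma \<phi>_eq_iff: "z \<in> U \<Longrightarrow> z' \<in> U \<Longrightarrow> \<phi> z = \<phi> z' \<longleftrightarrow> z = z'"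
  using smooth_chart_inj[OF centre_chart(1)] by (auto simp: inj_on_def)

lemma \<phi>_eq_x_iff: "z \<in> U \<Longrightarrow> \<phi> z = x \<longleftrightarrow> z = 0"
  using \<phi>_eq_iff[of z 0] centre_chart by simp

lemma centre_in_M: "x \<in> pts M"
  using smooth_chart_subset[OF centre_chart(1)] centre_chart(2,3) by blast

lemma \<phi>_in_M: "z \<in> U \<Longrightarrow> \<phi> z \<in> pts M"
  using smooth_chart_subset[OF centre_chart(1)] by blast

lemma fst_old_chart: "fst (old_chart d) = {z \<in> fst d. snd d z \<noteq> x}"
  and snd_old_chart: "snd (old_chart d) z = old_pt (snd d z)"
  and fst_new_chart: "fst (new_chart i) = {w. affine_point i w \<in> U}"
  and snd_new_chart: "snd (new_chart i) w = model_pt (snd (affine_chart U i) w)"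
  by (simp_all add: old_chart_def new_chart_def)

lemma atlas_blowup: "atlas Bl = old_chart ` atlas M \<union> range new_chart"
proof -
  have "{(fst d, \<lambda>w. model_pt (snd d w)) | d. d \<in> range (affine_chart U)} = range new_chart"
  proof -
    have "{(fst d, \<lambda>w. model_pt (snd d w)) | d. d \<in> range (affine_chart U)} =
        (\<lambda>d. (fst d, \<lambda>w. model_pt (snd d w))) ` range (affine_chart U)"
      by blast
    then show ?thesis
      by (simp add: image_image new_chart_def[abs_def] fst_affine_chart)
  qed
  moreover have "{({z \<in> fst d. snd d z \<noteq> x}, \<lambda>z. old_pt (snd d z)) | d. d \<in> atlas M} = old_chart ` atlas M"
    by (auto simp: old_chart_def)
  ultimately show ?thesis
    by (simp add: blowup_def)
qed

subsection \<open>Points of the blow-up\<close>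

lemma old_in_pre: "y \<in> pts M \<Longrightarrow> y \<noteq> x \<Longrightarrow> Inl y \<in> blowup_pre M x c"
  by (simp add: blowup_pre_def)

lemma model_in_pre: "p \<in> blowup_model U \<Longrightarrow> Inr p \<in> blowup_pre M x c"
  by (simp add: blowup_pre_def)

lemma pts_blowup: "pts Bl = old_pt ` (pts M - {x}) \<union> model_pt ` blowup_model U"
  unfolding blowup_def blowup_pre_def blowup_class_def quotient_def by auto

lemma blow_down_old: "y \<in> pts M \<Longrightarrow> y \<noteq> x \<Longrightarrow> blow_down c (old_pt y) = y"
  by (simp add: blow_down_class[OF old_in_pre])

lemma blow_down_model: "(z, L) \<in> blowup_model U \<Longrightarrow> blow_down c (model_pt (z, L)) = \<phi> z"
  by (simp add: blow_down_class[OF model_in_pre])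

lemma class_eq_iff:
  "s \<in> blowup_pre M x c \<Longrightarrow> t \<in> blowup_pre M x c \<Longrightarrow>
    blowup_class M x c s = blowup_class M x c t \<longleftrightarrow> (s, t) \<in> blowup_rel M x c"
  unfolding blowup_class_def by (rule eq_equiv_class_iff[OF equiv_blowup_rel])

lemma old_pt_eq_iff:
  "y \<in> pts M \<Longrightarrow> y \<noteq> x \<Longrightarrow> y' \<in> pts M \<Longrightarrow> y' \<noteq> x \<Longrightarrow> old_pt y = old_pt y' \<longleftrightarrow> y = y'"
  using blow_down_old by metis

lemma glued: "z \<in> U \<Longrightarrow> z \<noteq> 0 \<Longrightarrow> old_pt (\<phi> z) = model_pt (z, proj_point z)"
proof -
  assume z: "z \<in> U" "z \<noteq> 0"
  then have "Inl (\<phi> z) \<in> blowup_pre M x c" "Inr (z, proj_point z) \<in> blowup_pre M x c"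
    by (simp_all add: old_in_pre \<phi>_in_M \<phi>_eq_x_iff model_in_pre nonzero_in_blowup_model)
  moreover from this have "(Inl (\<phi> z), Inr (z, proj_point z)) \<in> blowup_rel M x c"
    using z unfolding blowup_rel_def Let_def by blast
  ultimately show ?thesis
    by (simp add: class_eq_iff)
qed

lemma old_pt_eq_model_pt_iff:
  assumes y: "y \<in> pts M" "y \<noteq> x" and p: "(z, L) \<in> blowup_model U"
  shows "old_pt y = model_pt (z, L) \<longleftrightarrow> z \<noteq> 0 \<and> y = \<phi> z"
proof -
  have z: "z \<in> U"
    using p by (elim blowup_model_cases) auto
  show ?thesis
  proof
    assume "old_pt y = model_pt (z, L)"
    then have "y = \<phi> z"
      using blow_down_old[OF y] blow_down_model[OF p] by simp
    then show "z \<noteq> 0 \<and> y = \<phi> z"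
      using y z \<phi>_eq_x_iff by auto
  next
    assume "z \<noteq> 0 \<and> y = \<phi> z"
    then show "old_pt y = model_pt (z, L)"
      using glued[OF z] blowup_model_nonzero[OF p] by simp
  qed
qed

lemma model_pt_eq_iff:
  assumes p: "p \<in> blowup_model U" and p': "p' \<in> blowup_model U"
  shows "model_pt p = model_pt p' \<longleftrightarrow> p = p'"
proof
  assume eq: "model_pt p = model_pt p'"
  obtain z L z' L' where pz: "p = (z, L)" "p' = (z', L')"
    by (cases p, cases p')
  have "z \<in> U" "z' \<in> U"
    using p p' pz by (auto elim!: blowup_model_cases)
  moreover have "\<phi> z = \<phi> z'"
    using eq blow_down_model p p' pz by metis
  ultimately have z: "z = z'"
    by (simp add: \<phi>_eq_iff)
  show "p = p'"
  proof (cases "z = 0")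
    case True
    \<comment> \<open>No generator of the relation involves a point of the exceptional divisor.\<close>
    let ?r = "{(Inl (\<phi> z), Inr (z, proj_point z)) | z. z \<in> U \<and> z \<noteq> 0}"
    have "(Inr p, Inr p') \<in> blowup_rel M x c"
      using eq p p' by (simp add: class_eq_iff model_in_pre)
    then have "(Inr p, Inr p') \<in> (?r \<union> ?r\<inverse>)\<^sup>*"
      by (simp add: blowup_rel_def Let_def)
    then show ?thesis
      by (rule converse_rtranclE) (use True pz in auto)
  next
    case False
    then show ?thesis
      using blowup_model_nonzero p p' pz z by metis
  qed
qed simp

subsection \<open>Charts of the blow-up\<close>

lemma new_chart_affine_coord:
  assumes "v $ i \<noteq> 0" "a *s v \<in> U"
  shows "affine_coord i (a *s v) v \<in> fst (new_chart i)"
    and "snd (new_chart i) (affine_coord i (a *s v) v) = model_pt (a *s v, proj_point v)"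
  using assms
  by (simp_all add: fst_new_chart snd_new_chart affine_point_affine_coord affine_chart_affine_coord)

lemma model_pt_in_new_chart:
  assumes "v \<noteq> 0" "a *s v \<in> U"
  shows "model_pt (a *s v, proj_point v) \<in> cimage (new_chart i) \<longleftrightarrow> v $ i \<noteq> 0"
proof
  assume "model_pt (a *s v, proj_point v) \<in> cimage (new_chart i)"
  then obtain w where w: "affine_point i w \<in> U"
    and "model_pt (a *s v, proj_point v) = model_pt (snd (affine_chart U i) w)"
    by (auto simp: fst_new_chart snd_new_chart)
  then have "snd (affine_chart U i) w = (a *s v, proj_point v)"
    using assms by (subst (asm) model_pt_eq_iff) (auto simp: mem_blowup_model affine_chart_in_model)
  then show "v $ i \<noteq> 0"
    by (rule affine_chart_eqD(1)[OF assms(1)])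
next
  assume "v $ i \<noteq> 0"
  then show "model_pt (a *s v, proj_point v) \<in> cimage (new_chart i)"
    using new_chart_affine_coord[OF _ assms(2)] by (metis image_eqI)
qed

lemma snd_new_chart_eq:
  "snd (new_chart i) w = model_pt (w $ i *s affine_vec i w, proj_point (affine_vec i w))"
  by (simp add: snd_new_chart snd_affine_chart)

lemma blow_down_new_chart: "affine_point i w \<in> U \<Longrightarrow> blow_down c (snd (new_chart i) w) = \<phi> (affine_point i w)"
  using affine_chart_in_model[of w i U] by (simp add: snd_new_chart snd_affine_chart blow_down_model)

lemma new_chart_nonexceptional:
  assumes "affine_point i w \<in> U" "w $ i \<noteq> 0"
  shows "snd (new_chart i) w = old_pt (\<phi> (affine_point i w))"
proof -
  have "proj_point (affine_point i w) = proj_point (affine_vec i w)"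
    using assms(2) by (subst proj_point_eq_iff) auto
  then show ?thesis
    using glued[OF assms(1)] assms(2) by (simp add: snd_new_chart_eq)
qed

lemma old_pt_in_old_chart:
  assumes d: "smooth_chart M d" and y: "y \<in> pts M" "y \<noteq> x"
  shows "old_pt y \<in> cimage (old_chart d) \<longleftrightarrow> y \<in> cimage d"
proof
  assume "old_pt y \<in> cimage (old_chart d)"
  then obtain z where z: "z \<in> fst d" "snd d z \<noteq> x" "old_pt y = old_pt (snd d z)"
    by (auto simp: fst_old_chart snd_old_chart)
  then have "y = snd d z"
    using y smooth_chart_subset[OF d] old_pt_eq_iff by blast
  then show "y \<in> cimage d"
    using z by blast
next
  assume "y \<in> cimage d"
  then show "old_pt y \<in> cimage (old_chart d)"
    using y by (auto simp: fst_old_chart snd_old_chart)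
qed

lemma open_old_chart: "smooth_chart M d \<Longrightarrow> open (fst (old_chart d))"
proof -
  assume d: "smooth_chart M d"
  have "fst (old_chart d) = fst d - (if x \<in> cimage d then {coord d x} else {})"
    by (auto simp: fst_old_chart coord_snd[OF d] dest: inj_onD[OF smooth_chart_inj[OF d]])
  then show ?thesis
    using smooth_chart_open[OF d] by (simp add: open_delete)
qed

lemma open_new_chart: "open (fst (new_chart i))"
  by (simp add: fst_new_chart open_affine_preimage open_U)

lemma inj_old_chart: "smooth_chart M d \<Longrightarrow> inj_on (snd (old_chart d)) (fst (old_chart d))"
proof (rule inj_onI)
  fix z z' assume d: "smooth_chart M d" and z: "z \<in> fst (old_chart d)" "z' \<in> fst (old_chart d)"
    and eq: "snd (old_chart d) z = snd (old_chart d) z'"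
  then have "snd d z = snd d z'"
    using smooth_chart_subset[OF d] by (auto simp: fst_old_chart snd_old_chart old_pt_eq_iff image_subset_iff)
  then show "z = z'"
    using z smooth_chart_inj[OF d] by (auto simp: fst_old_chart inj_on_def)
qed

lemma inj_new_chart: "inj_on (snd (new_chart i)) (fst (new_chart i))"
proof (rule inj_onI)
  fix w w' assume "w \<in> fst (new_chart i)" "w' \<in> fst (new_chart i)"
    and "snd (new_chart i) w = snd (new_chart i) w'"
  then have "snd (affine_chart U i) w = snd (affine_chart U i) w'"
    by (simp add: fst_new_chart snd_new_chart model_pt_eq_iff affine_chart_in_model)
  then show "w = w'"
    using inj_affine_chart by (auto simp: inj_def)
qed

lemma old_old_smooth:
  assumes d: "smooth_chart M d" and e: "smooth_chart M e"
  shows "smooth_in_charts (old_chart d) (old_chart e) (\<lambda>P. P)"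
proof -
  let ?W = "{z \<in> fst (old_chart d). snd d z \<in> cimage e}"
  have eq: "?W = fst (old_chart d) \<inter> {z \<in> fst d. snd d z \<in> cimage e}"
    by (auto simp: fst_old_chart)
  note de = smooth_charts_compatible[OF M d e]
  show ?thesis
  proof (rule smooth_in_chartsI(1)[where W = ?W and g = "in_charts d e (\<lambda>p. p)"])
    show "open ?W"
      unfolding eq by (intro open_Int open_old_chart d smooth_in_charts_open[OF de])
    show "smooth_on ?W (in_charts d e (\<lambda>p. p))"
      unfolding eq by (rule smooth_on_subset[OF smooth_in_charts_smooth[OF de]]) auto
    show "inj_on (snd (old_chart e)) (fst (old_chart e))"
      by (rule inj_old_chart[OF e])
    fix z assume z: "z \<in> fst (old_chart d)"
    then have "snd d z \<in> pts M" "snd d z \<noteq> x"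
      using smooth_chart_subset[OF d] by (auto simp: fst_old_chart)
    then show "snd (old_chart d) z \<in> cimage (old_chart e) \<longleftrightarrow> z \<in> ?W"
      using z old_pt_in_old_chart[OF e] by (simp add: snd_old_chart)
  next
    fix z assume "z \<in> ?W"
    then show "coord e (snd d z) \<in> fst (old_chart e)"
        "snd (old_chart d) z = snd (old_chart e) (coord e (snd d z))"
      by (simp_all add: fst_old_chart snd_old_chart coord_in snd_coord)
  qed auto
qed

lemma old_new_smooth:
  assumes d: "smooth_chart M d"
  shows "smooth_in_charts (old_chart d) (new_chart i) (\<lambda>P. P)"
proof -
  let ?T = "in_charts d c (\<lambda>p. p)"
  let ?V = "{z \<in> fst d. snd d z \<in> cimage c}"
  let ?H = "{q :: complex ^ 'n. q $ i \<noteq> 0}"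
  let ?W = "{z \<in> ?V. ?T z \<in> ?H}"
  have H: "open ?H"
    by (intro open_Collect_neq continuous_intros)
  note dc = smooth_charts_compatible[OF M d centre_chart(1)]
  have W: "open ?W"
    by (rule smooth_on_compose_preimage(1)[OF smooth_in_charts_open[OF dc] H
          smooth_in_charts_smooth[OF dc] smooth_on_ident[OF H]])
  have T: "smooth_on ?W ?T"
    by (rule smooth_on_subset[OF smooth_in_charts_smooth[OF dc]]) auto
  have W': "\<phi> (?T z) = snd d z" "?T z \<in> U" "?T z $ i \<noteq> 0" "?T z \<noteq> 0" if "z \<in> ?W" for z
    using that by (auto simp: snd_coord coord_in simp del: image_iff)
  show ?thesis
  proof (rule smooth_in_chartsI(1)[where W = ?W and g = "\<lambda>z. affine_coord i (?T z) (?T z)"])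
    show "open ?W"
      by (rule W)
    show "smooth_on ?W (\<lambda>z. affine_coord i (?T z) (?T z))"
      by (rule smooth_affine_coord[OF W T T]) auto
    show "inj_on (snd (new_chart i)) (fst (new_chart i))"
      by (rule inj_new_chart)
    show "?W \<subseteq> fst (old_chart d)"
    proof
      fix z assume z: "z \<in> ?W"
      then have "\<phi> (?T z) \<noteq> x"
        using \<phi>_eq_x_iff[OF W'(2)[OF z]] W'(4)[OF z] by blast
      then show "z \<in> fst (old_chart d)"
        using z W'(1)[OF z] by (simp add: fst_old_chart)
    qed
    fix z assume z: "z \<in> ?W"
    show "affine_coord i (?T z) (?T z) \<in> fst (new_chart i)"
      using new_chart_affine_coord(1)[of "?T z" i 1] W'[OF z] by simp
    show "snd (old_chart d) z = snd (new_chart i) (affine_coord i (?T z) (?T z))"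
      using new_chart_affine_coord(2)[of "?T z" i 1] W'[OF z] glued[OF W'(2,4)[OF z]]
      by (simp add: snd_old_chart)
  next
    fix z assume z: "z \<in> fst (old_chart d)"
    then have y: "snd d z \<in> pts M" "snd d z \<noteq> x"
      using smooth_chart_subset[OF d] by (auto simp: fst_old_chart)
    show "snd (old_chart d) z \<in> cimage (new_chart i) \<longleftrightarrow> z \<in> ?W"
    proof
      assume "snd (old_chart d) z \<in> cimage (new_chart i)"
      then obtain w where w: "affine_point i w \<in> U"
        and eq: "old_pt (snd d z) = model_pt (affine_point i w, proj_point (affine_vec i w))"
        by (auto simp: fst_new_chart snd_old_chart snd_new_chart_eq)
      then have "affine_point i w \<noteq> 0 \<and> snd d z = \<phi> (affine_point i w)"
        using old_pt_eq_model_pt_iff[OF y, of "affine_point i w" "proj_point (affine_vec i w)"]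
          affine_chart_in_model[OF w] by (simp add: snd_affine_chart)
      then show "z \<in> ?W"
        using z w coord_snd[OF centre_chart(1) w] by (auto simp: fst_old_chart)
    next
      assume z: "z \<in> ?W"
      show "snd (old_chart d) z \<in> cimage (new_chart i)"
        using model_pt_in_new_chart[of "?T z" 1 i] glued[OF W'(2,4)[OF z]] W'[OF z]
        by (simp add: snd_old_chart)
    qed
  qed
qed

lemma new_old_smooth:
  assumes d: "smooth_chart M d"
  shows "smooth_in_charts (new_chart i) (old_chart d) (\<lambda>P. P)"
proof -
  let ?T = "in_charts c d (\<lambda>p. p)"
  let ?V = "{q \<in> U. \<phi> q \<in> cimage d}"
  let ?H = "{w :: complex ^ 'n. w $ i \<noteq> 0}"
  let ?W = "{w \<in> ?H. affine_point i w \<in> ?V}"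
  have H: "open ?H"
    by (intro open_Collect_neq continuous_intros)
  note cd = smooth_charts_compatible[OF M centre_chart(1) d]
  note W = smooth_on_compose_preimage[OF H smooth_in_charts_open[OF cd] smooth_affine_point[OF H]
      smooth_in_charts_smooth[OF cd]]
  show ?thesis
  proof (rule smooth_in_chartsI(1)[where W = ?W and g = "\<lambda>w. ?T (affine_point i w)"])
    show "open ?W" "smooth_on ?W (\<lambda>w. ?T (affine_point i w))"
      by (rule W)+
    show "inj_on (snd (old_chart d)) (fst (old_chart d))"
      by (rule inj_old_chart[OF d])
    show "?W \<subseteq> fst (new_chart i)"
      by (auto simp: fst_new_chart)
    fix w assume w: "w \<in> ?W"
    then have x: "\<phi> (affine_point i w) \<noteq> x"
      by (simp add: \<phi>_eq_x_iff)
    then show "?T (affine_point i w) \<in> fst (old_chart d)"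
      using w by (simp add: fst_old_chart coord_in snd_coord)
    show "snd (new_chart i) w = snd (old_chart d) (?T (affine_point i w))"
      using w x by (simp add: new_chart_nonexceptional snd_old_chart snd_coord)
  next
    fix w assume w: "w \<in> fst (new_chart i)"
    show "snd (new_chart i) w \<in> cimage (old_chart d) \<longleftrightarrow> w \<in> ?W"
    proof
      assume "snd (new_chart i) w \<in> cimage (old_chart d)"
      then obtain z where z: "z \<in> fst d" "snd d z \<noteq> x"
        and "old_pt (snd d z) = model_pt (affine_point i w, proj_point (affine_vec i w))"
        by (auto simp: fst_old_chart snd_old_chart snd_new_chart_eq)
      moreover have "snd d z \<in> pts M"
        using z smooth_chart_subset[OF d] by blast
      ultimately have "affine_point i w \<noteq> 0 \<and> snd d z = \<phi> (affine_point i w)"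
        using old_pt_eq_model_pt_iff[of "snd d z" "affine_point i w" "proj_point (affine_vec i w)"]
          affine_chart_in_model[of w i U] w by (simp add: snd_affine_chart fst_new_chart)
      then have "w $ i \<noteq> 0" "\<phi> (affine_point i w) \<in> cimage d"
        using z(1) by (auto intro: rev_image_eqI)
      then show "w \<in> ?W"
        using w by (simp add: fst_new_chart)
    next
      assume w: "w \<in> ?W"
      then have "\<phi> (affine_point i w) \<noteq> x" "\<phi> (affine_point i w) \<in> pts M"
        by (simp_all add: \<phi>_eq_x_iff \<phi>_in_M)
      then show "snd (new_chart i) w \<in> cimage (old_chart d)"
        using w by (simp add: new_chart_nonexceptional old_pt_in_old_chart[OF d])
    qed
  qed
qed

lemma new_new_smooth:
  shows "smooth_in_charts (new_chart i) (new_chart j) (\<lambda>P. P)"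
    and "w \<in> fst (new_chart i) \<Longrightarrow> affine_vec i w $ j \<noteq> 0 \<Longrightarrow>
      in_charts (new_chart i) (new_chart j) (\<lambda>P. P) w =
      affine_coord j (affine_point i w) (affine_vec i w)"
    and "w \<in> fst (new_chart i) \<Longrightarrow>
      snd (new_chart i) w \<in> cimage (new_chart j) \<longleftrightarrow> affine_vec i w $ j \<noteq> 0"
proof -
  let ?W = "{w \<in> fst (new_chart i). affine_vec i w $ j \<noteq> 0}"
  have "?W = fst (new_chart i) \<inter> {w. affine_vec i w \<in> {u. u $ j \<noteq> 0}}"
    by auto
  also have "open \<dots>"
    by (intro open_Int open_new_chart open_affine_vec_preimage open_Collect_neq continuous_intros)
  finally have W: "open ?W" .
  have mem: "snd (new_chart i) w \<in> cimage (new_chart j) \<longleftrightarrow> affine_vec i w $ j \<noteq> 0"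
    if "w \<in> fst (new_chart i)" for w
    using that model_pt_in_new_chart[of "affine_vec i w" "w $ i" j]
    by (simp add: fst_new_chart snd_new_chart_eq)
  then show "w \<in> fst (new_chart i) \<Longrightarrow>
      snd (new_chart i) w \<in> cimage (new_chart j) \<longleftrightarrow> affine_vec i w $ j \<noteq> 0"
    by blast
  have smooth: "smooth_on ?W (\<lambda>w. affine_coord j (affine_point i w) (affine_vec i w))"
    by (rule smooth_affine_coord[OF W smooth_affine_point[OF W] smooth_affine_vec[OF W]]) auto
  have maps: "affine_coord j (affine_point i w) (affine_vec i w) \<in> fst (new_chart j)"
    "snd (new_chart i) w = snd (new_chart j) (affine_coord j (affine_point i w) (affine_vec i w))"
    if "w \<in> ?W" for w
    using that new_chart_affine_coord[of "affine_vec i w" j "w $ i"]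
    by (simp_all add: fst_new_chart snd_new_chart_eq)
  note * = smooth_in_chartsI[where c = "new_chart i" and f = "\<lambda>P. P", OF W smooth inj_new_chart _ _ maps]
  show "smooth_in_charts (new_chart i) (new_chart j) (\<lambda>P. P)"
    by (rule *) (use mem in auto)
  show "in_charts (new_chart i) (new_chart j) (\<lambda>P. P) w =
      affine_coord j (affine_point i w) (affine_vec i w)"
    if "w \<in> fst (new_chart i)" "affine_vec i w $ j \<noteq> 0"
    by (rule *) (use mem that in auto)
qed

lemma smooth_chart_blowup:
  assumes "C \<in> atlas Bl"
  shows "smooth_chart Bl C"
proof -
  from assms consider d where "d \<in> atlas M" "C = old_chart d" | i where "C = new_chart i"
    by (auto simp: atlas_blowup)
  then show ?thesis
  proof cases
    case 1
    have d: "smooth_chart M d"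
      using atlas_smooth_chart[OF M 1(1)] .
    have "cimage C \<subseteq> pts Bl"
      using smooth_chart_subset[OF d] by (auto simp: 1(2) fst_old_chart snd_old_chart pts_blowup)
    then show ?thesis
      using open_old_chart[OF d] inj_old_chart[OF d] atlas_smooth_chart[OF M]
      by (auto simp: smooth_chart_def[of Bl] 1(2) atlas_blowup compatible_def d
          intro!: old_old_smooth old_new_smooth new_old_smooth)
  next
    case 2
    have "cimage C \<subseteq> pts Bl"
      by (auto simp: 2 fst_new_chart snd_new_chart pts_blowup intro!: affine_chart_in_model)
    then show ?thesis
      using open_new_chart inj_new_chart atlas_smooth_chart[OF M]
      by (auto simp: smooth_chart_def[of Bl] 2 atlas_blowup compatible_def
          intro!: new_new_smooth(1) old_new_smooth new_old_smooth)
  qed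
qed

lemma charts_cover_blowup: "(\<Union>C\<in>atlas Bl. cimage C) = pts Bl"
proof
  show "(\<Union>C\<in>atlas Bl. cimage C) \<subseteq> pts Bl"
    using smooth_chart_subset[OF smooth_chart_blowup] by blast
  show "pts Bl \<subseteq> (\<Union>C\<in>atlas Bl. cimage C)"
  proof
    fix P assume "P \<in> pts Bl"
    then consider y where "y \<in> pts M" "y \<noteq> x" "P = old_pt y"
      | p where "p \<in> blowup_model U" "P = model_pt p"
      by (auto simp: pts_blowup)
    then show "P \<in> (\<Union>C\<in>atlas Bl. cimage C)"
    proof cases
      case 1
      then obtain d where "d \<in> atlas M" "y \<in> cimage d"
        using atlas_covers[OF M] by blast
      then show ?thesis
        using 1 old_pt_in_old_chart[OF atlas_smooth_chart[OF M]] by (auto simp: atlas_blowup)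
    next
      case 2
      then obtain a v where v: "v \<noteq> 0" "a *s v \<in> U" "P = model_pt (a *s v, proj_point v)"
        by (auto elim: blowup_model_cases)
      then obtain i where "v $ i \<noteq> 0"
        by (auto simp: vec_eq_iff)
      then have "P \<in> cimage (new_chart i)"
        using v model_pt_in_new_chart by simp
      then show ?thesis
        by (auto simp: atlas_blowup)
    qed
  qed
qed


subsection \<open>Topology of the blow-up\<close>

lemma openin_blowup:
  "openin (mfd_topology Bl) W \<longleftrightarrow> W \<subseteq> pts Bl \<and>
    (\<forall>d\<in>atlas M. open {z \<in> fst (old_chart d). old_pt (snd d z) \<in> W}) \<and>
    (\<forall>i. open {w \<in> fst (new_chart i). snd (new_chart i) w \<in> W})"
  by (simp add: openin_mfd_topology atlas_blowup ball_Un snd_old_chart)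

lemma old_pt_in_blowup: "y \<in> pts M \<Longrightarrow> y \<noteq> x \<Longrightarrow> old_pt y \<in> pts Bl"
  by (simp add: pts_blowup)

lemma new_chart_in_blowup: "w \<in> fst (new_chart i) \<Longrightarrow> snd (new_chart i) w \<in> pts Bl"
  by (simp add: pts_blowup fst_new_chart snd_new_chart affine_chart_in_model)

lemma old_chart_pt:
  assumes "smooth_chart M d" "z \<in> fst (old_chart d)"
  shows "snd d z \<in> pts M" "snd d z \<noteq> x"
  using assms smooth_chart_subset[OF assms(1)] by (auto simp: fst_old_chart)

lemma blow_down_pts:
  assumes "P \<in> pts Bl"
  shows "blow_down c P \<in> pts M"
proof -
  from assms consider y where "y \<in> pts M" "y \<noteq> x" "P = old_pt y"
    | z L where "(z, L) \<in> blowup_model U" "P = model_pt (z, L)"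
    unfolding pts_blowup by fast
  then show ?thesis
  proof cases
    case 1
    then show ?thesis
      using blow_down_old[OF 1(1,2)] by simp
  next
    case 2
    then have "z \<in> U"
      by (auto elim!: blowup_model_cases)
    then show ?thesis
      using blow_down_model[OF 2(1)] \<phi>_in_M 2(2) by simp
  qed
qed

lemma blow_down_continuous:
  assumes V: "openin (mfd_topology M) V"
  shows "openin (mfd_topology Bl) {P \<in> pts Bl. blow_down c P \<in> V}"
  unfolding openin_blowup
proof (intro conjI ballI allI)
  fix d assume "d \<in> atlas M"
  then have d: "smooth_chart M d"
    by (rule atlas_smooth_chart[OF M])
  have "{z \<in> fst (old_chart d). old_pt (snd d z) \<in> {P \<in> pts Bl. blow_down c P \<in> V}} =
      fst (old_chart d) \<inter> {z \<in> fst d. snd d z \<in> V}"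
  proof -
    have "old_pt (snd d z) \<in> {P \<in> pts Bl. blow_down c P \<in> V} \<longleftrightarrow> snd d z \<in> V"
      if "z \<in> fst (old_chart d)" for z
      using old_chart_pt[OF d that] by (simp add: old_pt_in_blowup blow_down_old)
    moreover have "fst (old_chart d) \<subseteq> fst d"
      by (auto simp: fst_old_chart)
    ultimately show ?thesis
      by blast
  qed
  then show "open {z \<in> fst (old_chart d). old_pt (snd d z) \<in> {P \<in> pts Bl. blow_down c P \<in> V}}"
    using open_old_chart[OF d] open_chart_preimage[OF M d V] by (simp add: open_Int)
next
  fix i
  have "{w \<in> fst (new_chart i). snd (new_chart i) w \<in> {P \<in> pts Bl. blow_down c P \<in> V}} =
      {w. affine_point i w \<in> {q \<in> U. \<phi> q \<in> V}}"
    using new_chart_in_blowup blow_down_new_chart by (auto simp: fst_new_chart)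
  then show "open {w \<in> fst (new_chart i). snd (new_chart i) w \<in> {P \<in> pts Bl. blow_down c P \<in> V}}"
    using open_affine_preimage[OF open_chart_preimage[OF M centre_chart(1) V]] by simp
qed auto

text \<open>The projection is injective off the exceptional divisor. This reduces the separation axiom to that
  of \<open>M\<close> and to the separation of two lines over the centre.\<close>

lemma blowup_eq_or_exceptional:
  assumes "P \<in> pts Bl" "Q \<in> pts Bl" "blow_down c P = blow_down c Q" "P \<noteq> Q"
  obtains u v where "u \<noteq> 0" "v \<noteq> 0" "P = model_pt (0, proj_point u)" "Q = model_pt (0, proj_point v)"
proof -
  have *: "blow_down c R \<noteq> x \<and> R = old_pt (blow_down c R) \<or> (\<exists>u. u \<noteq> 0 \<and> R = model_pt (0, proj_point u))"
    if "R \<in> pts Bl" for R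
  proof -
    from that consider y where "y \<in> pts M" "y \<noteq> x" "R = old_pt y"
      | p where "p \<in> blowup_model U" "R = model_pt p"
      by (auto simp: pts_blowup)
    then show ?thesis
    proof cases
      case 1
      then show ?thesis
        using blow_down_old by simp
    next
      case 2
      then obtain a v where v: "v \<noteq> 0" "a *s v \<in> U" and p: "p = (a *s v, proj_point v)"
        by (auto elim: blowup_model_cases)
      show ?thesis
      proof (cases "a = 0")
        case True
        then show ?thesis
          using v p 2 by auto
      next
        case False
        then have "a *s v \<noteq> 0"
          using v by simp
        moreover from this have "proj_point v = proj_point (a *s v)"
          using 2 p blowup_model_nonzero by blast
        ultimately show ?thesis
          using glued[OF v(2)] 2 p blow_down_model \<phi>_eq_x_iff[OF v(2)] by simp
      qed
    qed
  qed
  have down: "blow_down c (model_pt (0, proj_point u)) = x" if "u \<noteq> 0" for u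
    using that centre_chart by (subst blow_down_model) (auto simp: mem_blowup_model intro: exI[of _ 0])
  show thesis
    using *[OF assms(1)] *[OF assms(2)] assms down that by metis
qed

text \<open>A sign condition on the spanning vector that is invariant under scaling is a condition on the
  line, and it is open in every chart.\<close>

lemma openin_lines_where_positive:
  fixes h :: "complex ^ 'n \<Rightarrow> real"
  assumes h: "continuous_on UNIV h" and scale: "\<And>a u. a \<noteq> 0 \<Longrightarrow> h (a *s u) > 0 \<longleftrightarrow> h u > 0"
  shows "openin (mfd_topology Bl)
    {model_pt (z, proj_point u) | z u. u \<noteq> 0 \<and> (z, proj_point u) \<in> blowup_model U \<and> h u > 0}"
    (is "openin _ ?A")
proof -
  have h_cong: "h u > 0 \<longleftrightarrow> h v > 0" if "u \<noteq> 0" "v \<noteq> 0" "proj_point u = proj_point v" for u v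
    using that scale by (auto simp: proj_point_eq_iff)
  have pos: "open {u. h u > 0}"
    using h by (intro open_Collect_less) auto
  show ?thesis
    unfolding openin_blowup
  proof (intro conjI ballI allI)
    have A: "model_pt (z, proj_point u) \<in> ?A \<longleftrightarrow> h u > 0"
      if "u \<noteq> 0" "(z, proj_point u) \<in> blowup_model U" for z u
    proof
      assume "model_pt (z, proj_point u) \<in> ?A"
      then obtain z' u' where "model_pt (z, proj_point u) = model_pt (z', proj_point u')"
        "u' \<noteq> 0" "(z', proj_point u') \<in> blowup_model U" "h u' > 0"
        by blast
      then show "h u > 0"
        using that h_cong[of u u'] by (simp add: model_pt_eq_iff)
    next
      assume "h u > 0"
      then show "model_pt (z, proj_point u) \<in> ?A"
        using that by blast
    qed
    show "?A \<subseteq> pts Bl"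
      by (auto simp: pts_blowup)
    fix i
    have "{w \<in> fst (new_chart i). snd (new_chart i) w \<in> ?A} =
        fst (new_chart i) \<inter> {w. affine_vec i w \<in> {u. h u > 0}}"
    proof -
      have "snd (new_chart i) w \<in> ?A \<longleftrightarrow> h (affine_vec i w) > 0" if "w \<in> fst (new_chart i)" for w
        unfolding snd_new_chart_eq using that affine_chart_in_model[of w i U]
        by (intro A) (simp_all add: fst_new_chart snd_affine_chart)
      then show ?thesis
        by blast
    qed
    then show "open {w \<in> fst (new_chart i). snd (new_chart i) w \<in> ?A}"
      using open_new_chart open_affine_vec_preimage[OF pos] by (simp add: open_Int)
  next
    fix d assume "d \<in> atlas M"
    then have d: "smooth_chart M d"
      by (rule atlas_smooth_chart[OF M])
    note dc = smooth_charts_compatible[OF M d centre_chart(1)]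
    let ?V = "{z \<in> fst d. snd d z \<in> cimage c}"
    have "{z \<in> fst (old_chart d). old_pt (snd d z) \<in> ?A} =
        fst (old_chart d) \<inter> {z \<in> ?V. coord c (snd d z) \<in> {u. h u > 0}}"
    proof -
      have "old_pt (snd d z) \<in> ?A \<longleftrightarrow> snd d z \<in> cimage c \<and> h (coord c (snd d z)) > 0"
        if z: "z \<in> fst (old_chart d)" for z
      proof
        assume "old_pt (snd d z) \<in> ?A"
        then obtain q u where qu: "old_pt (snd d z) = model_pt (q, proj_point u)"
          "u \<noteq> 0" "(q, proj_point u) \<in> blowup_model U" "h u > 0"
          by blast
        then have q: "q \<noteq> 0" "snd d z = \<phi> q"
          using old_pt_eq_model_pt_iff[OF old_chart_pt[OF d z] qu(3)] by blast+
        have "q \<in> U"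
          using qu(3) by (auto elim!: blowup_model_cases)
        moreover have "h q > 0"
          using h_cong[of u q] qu q blowup_model_nonzero[OF qu(3)] by simp
        ultimately show "snd d z \<in> cimage c \<and> h (coord c (snd d z)) > 0"
          using coord_snd[OF centre_chart(1), of q] unfolding q(2) by simp
      next
        assume *: "snd d z \<in> cimage c \<and> h (coord c (snd d z)) > 0"
        define q where "q = coord c (snd d z)"
        have q: "q \<in> U" "\<phi> q = snd d z" "h q > 0"
          using * coord_in[of "snd d z" c] snd_coord[of "snd d z" c] by (simp_all add: q_def)
        then have "q \<noteq> 0"
          using old_chart_pt(2)[OF d z] \<phi>_eq_x_iff by force
        then show "old_pt (snd d z) \<in> ?A"
          using q glued[of q] nonzero_in_blowup_model[of q U] by auto
      qed
      moreover have "fst (old_chart d) \<subseteq> fst d"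
        by (auto simp: fst_old_chart)
      moreover have "{z \<in> F. P z} = F \<inter> {z \<in> {z \<in> D. R z}. f z \<in> {u. h u > 0}}"
        if "\<And>z. z \<in> F \<Longrightarrow> P z \<longleftrightarrow> R z \<and> h (f z) > 0" "F \<subseteq> D" for F D P R f
        using that by blast
      ultimately show ?thesis
        by blast
    qed
    moreover have "open {z \<in> ?V. coord c (snd d z) \<in> {u. h u > 0}}"
      by (rule smooth_on_compose_preimage(1)[OF smooth_in_charts_open[OF dc] pos
            smooth_in_charts_smooth[OF dc] smooth_on_ident[OF pos]])
    ultimately show "open {z \<in> fst (old_chart d). old_pt (snd d z) \<in> ?A}"
      using open_old_chart[OF d] by (simp add: open_Int)
  qed
qed

lemma topspace_blowup: "topspace (mfd_topology Bl) = pts Bl"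
proof -
  have "{z \<in> fst C. snd C z \<in> pts Bl} = fst C" if "C \<in> atlas Bl" for C
    using smooth_chart_subset[OF smooth_chart_blowup[OF that]] by auto
  then have "openin (mfd_topology Bl) (pts Bl)"
    using smooth_chart_open[OF smooth_chart_blowup] by (auto simp: openin_mfd_topology)
  then show ?thesis
    by (meson openin_mfd_topology openin_subset openin_topspace subset_antisym)
qed

text \<open>Two lines \<open>[u]\<close> and \<open>[v]\<close> over the centre are separated by comparing the absolute values of a
  minor of \<open>(u, a)\<close> and of the same minor of \<open>(v, a)\<close>, where \<open>a\<close> spans the varying line. The minor is
  chosen such that it does not vanish for the pair \<open>(u, v)\<close>: at \<open>a = u\<close> the first value is 0 and the
  second is not, and conversely at \<open>a = v\<close>.\<close>

lemma separate_exceptional: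
  assumes u: "u \<noteq> 0" "v \<noteq> 0" and ne: "proj_point u \<noteq> proj_point v"
  shows "\<exists>A B. openin (mfd_topology Bl) A \<and> openin (mfd_topology Bl) B \<and>
    model_pt (0, proj_point u) \<in> A \<and> model_pt (0, proj_point v) \<in> B \<and> disjnt A B"
proof -
  have "\<not> (\<exists>a. u = a *s v)"
    using u ne by (auto simp: proj_point_eq_iff)
  then obtain j k where jk: "u $ j * v $ k - u $ k * v $ j \<noteq> 0"
    using minors_eq_0_iff[OF u(2), of u] by blast
  define m where "m b a = norm (b $ j * a $ k - b $ k * a $ j)" for a b :: "complex ^ 'n"
  define h where "h s t a = m t a - m s a" for s t a
  define A where "A s t = {model_pt (z, proj_point a) | z a.
      a \<noteq> 0 \<and> (z, proj_point a) \<in> blowup_model U \<and> h s t a > 0}" for s t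
  have scale: "m b (r *s a) = norm r * m b a" for b r a
  proof -
    have "b $ j * (r *s a) $ k - b $ k * (r *s a) $ j = r * (b $ j * a $ k - b $ k * a $ j)"
      by (simp add: algebra_simps)
    then show ?thesis
      by (simp add: m_def norm_mult)
  qed
  have h_scale: "h s t (r *s a) > 0 \<longleftrightarrow> h s t a > 0" if "r \<noteq> 0" for s t r a
    using that by (simp add: h_def scale)
  have "continuous_on UNIV (h s t)" for s t
    unfolding h_def[abs_def] m_def[abs_def] by (intro continuous_intros)
  then have open_A: "openin (mfd_topology Bl) (A s t)" for s t
    unfolding A_def using h_scale by (rule openin_lines_where_positive)
  have mem: "model_pt (0, proj_point s) \<in> A s t" if "s \<noteq> 0" "m t s \<noteq> 0" for s t
  proof -
    have "h s t s > 0"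
      using that by (simp add: h_def m_def)
    moreover have "(0, proj_point s) \<in> blowup_model U"
      using that(1) centre_chart(2) by (auto simp: mem_blowup_model intro: exI[of _ 0])
    ultimately show ?thesis
      using that(1) unfolding A_def by blast
  qed
  have "disjnt (A u v) (A v u)"
    unfolding disjnt_iff
  proof (intro allI notI)
    fix P assume "P \<in> A u v \<and> P \<in> A v u"
    then obtain z a z' a' where "a \<noteq> 0" "a' \<noteq> 0" "(z, proj_point a) = (z', proj_point a')"
      "h u v a > 0" "h v u a' > 0"
      unfolding A_def using model_pt_eq_iff by blast
    then show False
      using h_scale by (auto simp: proj_point_eq_iff) (auto simp: h_def)
  qed
  moreover have "m v u \<noteq> 0" "m u v \<noteq> 0"
    using jk by (auto simp: m_def algebra_simps)
  ultimately show ?thesis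
    using open_A[of u v] open_A[of v u] mem[of u v] mem[of v u] u
    by (intro exI[of _ "A u v"] exI[of _ "A v u"]) simp
qed

lemma Hausdorff_blowup: "Hausdorff_space (mfd_topology Bl)"
  unfolding Hausdorff_space_def topspace_blowup
proof (intro allI impI, elim conjE)
  fix P Q assume PQ: "P \<in> pts Bl" "Q \<in> pts Bl" "P \<noteq> Q"
  show "\<exists>A B. openin (mfd_topology Bl) A \<and> openin (mfd_topology Bl) B \<and> P \<in> A \<and> Q \<in> B \<and> disjnt A B"
  proof (cases "blow_down c P = blow_down c Q")
    case True
    then obtain u v where uv: "u \<noteq> 0" "v \<noteq> 0"
      "P = model_pt (0, proj_point u)" "Q = model_pt (0, proj_point v)"
      using blowup_eq_or_exceptional PQ by metis
    then have "proj_point u \<noteq> proj_point v"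
      using PQ(3) by metis
    from separate_exceptional[OF uv(1,2) this] show ?thesis
      unfolding uv(3,4) .
  next
    case False
    have H: "Hausdorff_space (mfd_topology M)"
      using M by (simp add: smooth_manifold_def)
    have "blow_down c P \<in> topspace (mfd_topology M)" "blow_down c Q \<in> topspace (mfd_topology M)"
      using blow_down_pts PQ(1,2) by (simp_all add: topspace_mfd_topology[OF M])
    with False have "\<exists>A B. openin (mfd_topology M) A \<and> openin (mfd_topology M) B \<and>
        blow_down c P \<in> A \<and> blow_down c Q \<in> B \<and> disjnt A B"
      using H unfolding Hausdorff_space_def by simp
    then obtain A B where AB: "openin (mfd_topology M) A" "openin (mfd_topology M) B"
      "blow_down c P \<in> A" "blow_down c Q \<in> B" "disjnt A B"
      by (elim exE conjE)
    let ?pre = "\<lambda>V. {P \<in> pts Bl. blow_down c P \<in> V}"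
    have "disjnt (?pre A) (?pre B)"
      using AB(5) by (auto simp: disjnt_def)
    then show ?thesis
      using blow_down_continuous[OF AB(1)] blow_down_continuous[OF AB(2)] PQ(1,2) AB(3,4)
      by (intro exI[of _ "?pre A"] exI[of _ "?pre B"]) simp
  qed
qed

text \<open>Such a set is the preimage of \<open>V - {x}\<close> under the projection.\<close>

lemma openin_old_points:
  assumes V: "openin (mfd_topology M) V"
  shows "openin (mfd_topology Bl) (old_pt ` (V - {x}))"
proof -
  have "closedin (mfd_topology M) {x}"
    using M centre_in_M topspace_mfd_topology[OF M]
    by (simp add: smooth_manifold_def closedin_Hausdorff_singleton)
  then have "openin (mfd_topology M) (V - {x})"
    using V by (simp add: openin_diff)
  from blow_down_continuous[OF this]
  have o: "openin (mfd_topology Bl) {P \<in> pts Bl. blow_down c P \<in> V - {x}}" .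
  have V': "V \<subseteq> pts M"
    using V by (simp add: openin_mfd_topology)
  have "P \<in> old_pt ` (V - {x})" if P: "P \<in> pts Bl" "blow_down c P \<in> V - {x}" for P
  proof (rule image_eqI[OF _ P(2)])
    have "blow_down c P \<in> pts M" "blow_down c P \<noteq> x"
      using P V' by blast+
    note Q = old_pt_in_blowup[OF this] blow_down_old[OF this]
    show "P = old_pt (blow_down c P)"
    proof (rule ccontr)
      assume "P \<noteq> old_pt (blow_down c P)"
      then obtain u where "u \<noteq> 0" "P = model_pt (0, proj_point u)"
        using blowup_eq_or_exceptional[OF P(1) Q(1)] Q(2) by metis
      then have "blow_down c P = x"
        using centre_chart by (simp add: blow_down_model mem_blowup_model exI[of _ 0])
      then show False
        using P by blast
    qed
  qed
  moreover have "P \<in> pts Bl \<and> blow_down c P \<in> V - {x}" if "P \<in> old_pt ` (V - {x})" for P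
  proof -
    from that obtain y where y: "P = old_pt y" "y \<in> V" "y \<noteq> x" "y \<in> pts M"
      using V' by blast
    then show ?thesis
      using old_pt_in_blowup[OF y(4,3)] blow_down_old[OF y(4,3)] by simp
  qed
  ultimately have "{P \<in> pts Bl. blow_down c P \<in> V - {x}} = old_pt ` (V - {x})"
    by blast
  with o show ?thesis
    by simp
qed

text \<open>A base consists of the images of a base of \<open>M\<close>, without the centre, and of the images of a
  countable base of the model space under the finitely many affine charts.\<close>

lemma second_countable_blowup: "second_countable (mfd_topology Bl)"
proof -
  obtain \<B> where \<B>: "countable \<B>" "\<And>V. V \<in> \<B> \<Longrightarrow> openin (mfd_topology M) V"
    "\<And>W y. openin (mfd_topology M) W \<Longrightarrow> y \<in> W \<Longrightarrow> \<exists>V\<in>\<B>. y \<in> V \<and> V \<subseteq> W"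
    using M unfolding smooth_manifold_def second_countable_def by metis
  obtain \<C> :: "(complex ^ 'n) set set" where \<C>: "countable \<C>" "\<And>V. V \<in> \<C> \<Longrightarrow> open V"
    "\<And>S. open S \<Longrightarrow> \<exists>\<U>. \<U> \<subseteq> \<C> \<and> S = \<Union>\<U>"
    using univ_second_countable by metis
  define \<D> where "\<D> = (\<lambda>V. old_pt ` (V - {x})) ` \<B> \<union>
    (\<Union>i. (\<lambda>V. snd (new_chart i) ` (V \<inter> fst (new_chart i))) ` \<C>)"
  have "countable \<D>"
    unfolding \<D>_def using \<B>(1) \<C>(1) by (auto intro: countable_UN)
  moreover have "openin (mfd_topology Bl) W" if "W \<in> \<D>" for W
  proof -
    have "openin (mfd_topology Bl) (snd (new_chart i) ` (V \<inter> fst (new_chart i)))" if "V \<in> \<C>" for V i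
      using that \<C>(2) open_new_chart[of i]
      by (intro openin_chart_image smooth_chart_blowup) (auto simp: atlas_blowup)
    then show ?thesis
      using that openin_old_points \<B>(2) unfolding \<D>_def by auto
  qed
  moreover have "\<exists>V\<in>\<D>. P \<in> V \<and> V \<subseteq> W" if W: "openin (mfd_topology Bl) W" and P: "P \<in> W" for W P
  proof -
    have "P \<in> pts Bl"
      using W P by (auto simp: openin_blowup)
    then obtain C where "C \<in> atlas Bl" "P \<in> cimage C"
      using charts_cover_blowup by blast
    then consider d where "d \<in> atlas M" "P \<in> cimage (old_chart d)" | i where "P \<in> cimage (new_chart i)"
      unfolding atlas_blowup by blast
    then show ?thesis
    proof cases
      case 1
      then obtain z where z: "z \<in> fst d" "snd d z \<noteq> x" "P = old_pt (snd d z)"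
        by (auto simp: fst_old_chart snd_old_chart)
      let ?V = "{y \<in> pts M - {x}. old_pt y \<in> W}"
      have "openin (mfd_topology M) ?V"
        unfolding openin_mfd_topology
      proof (intro conjI ballI)
        fix e assume e: "e \<in> atlas M"
        have "{z \<in> fst e. snd e z \<in> ?V} = {z \<in> fst (old_chart e). old_pt (snd e z) \<in> W}"
          using smooth_chart_subset[OF atlas_smooth_chart[OF M e]] by (auto simp: fst_old_chart)
        then show "open {z \<in> fst e. snd e z \<in> ?V}"
          using W e by (simp add: openin_blowup)
      qed auto
      moreover have "snd d z \<in> ?V"
        using z P smooth_chart_subset[OF atlas_smooth_chart[OF M 1(1)]] by auto
      ultimately obtain V where V: "V \<in> \<B>" "snd d z \<in> V" "V \<subseteq> ?V"
        using \<B>(3) by blast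
      then have "old_pt ` (V - {x}) \<in> \<D>" "P \<in> old_pt ` (V - {x})" "old_pt ` (V - {x}) \<subseteq> W"
        using z unfolding \<D>_def by auto
      then show ?thesis
        by (intro bexI[of _ "old_pt ` (V - {x})"] conjI)
    next
      case 2
      then obtain w where w: "w \<in> fst (new_chart i)" "P = snd (new_chart i) w"
        by blast
      have "open {w \<in> fst (new_chart i). snd (new_chart i) w \<in> W}"
        using W by (simp add: openin_blowup)
      from \<C>(3)[OF this] obtain \<U> where \<U>: "\<U> \<subseteq> \<C>"
        "{w \<in> fst (new_chart i). snd (new_chart i) w \<in> W} = \<Union>\<U>"
        by (elim exE conjE)
      have "w \<in> {w \<in> fst (new_chart i). snd (new_chart i) w \<in> W}"
        using w P by simp
      then obtain V where V: "V \<in> \<C>" "w \<in> V" "V \<subseteq> {w \<in> fst (new_chart i). snd (new_chart i) w \<in> W}"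
        using \<U>(1) unfolding \<U>(2) by blast
      then have "snd (new_chart i) ` (V \<inter> fst (new_chart i)) \<in> \<D>"
        unfolding \<D>_def by blast
      moreover have "P \<in> snd (new_chart i) ` (V \<inter> fst (new_chart i))"
        "snd (new_chart i) ` (V \<inter> fst (new_chart i)) \<subseteq> W"
        using V w by auto
      ultimately show ?thesis
        by (intro bexI[of _ "snd (new_chart i) ` (V \<inter> fst (new_chart i))"] conjI)
    qed
  qed
  ultimately show ?thesis
    unfolding second_countable_def by blast
qed

lemma smooth_manifold_blowup: "smooth_manifold Bl"
  unfolding smooth_manifold_def
  using smooth_chart_blowup charts_cover_blowup Hausdorff_blowup second_countable_blowup by blast

subsection \<open>The projection in charts\<close>

lemma blow_down_old_chart:
  assumes "smooth_chart M d" "z \<in> fst (old_chart d)"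
  shows "blow_down c (snd (old_chart d) z) = snd d z"
  using blow_down_old[OF old_chart_pt[OF assms]] by (simp add: snd_old_chart)

lemma smooth_map_blow_down: "smooth_map Bl M (blow_down c)"
  unfolding smooth_map_def
proof (intro conjI ballI)
  have old: "smooth_in_charts (old_chart d) e (blow_down c)"
    if d: "smooth_chart M d" and e: "smooth_chart M e" for d e
  proof -
    let ?W = "fst (old_chart d) \<inter> {z \<in> fst d. snd d z \<in> cimage e}"
    note de = smooth_charts_compatible[OF M d e]
    show ?thesis
    proof (rule smooth_in_chartsI(1)[where W = ?W and g = "in_charts d e (\<lambda>p. p)"])
      show "open ?W"
        by (intro open_Int open_old_chart d smooth_in_charts_open[OF de])
      show "smooth_on ?W (in_charts d e (\<lambda>p. p))"
        by (rule smooth_on_subset[OF smooth_in_charts_smooth[OF de]]) auto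
      show "blow_down c (snd (old_chart d) z) \<in> cimage e \<longleftrightarrow> z \<in> ?W" if "z \<in> fst (old_chart d)" for z
        unfolding blow_down_old_chart[OF d that] using that by (simp add: fst_old_chart)
      show "coord e (snd d z) \<in> fst e" if "z \<in> ?W" for z
        using that by (simp add: coord_in)
      show "blow_down c (snd (old_chart d) z) = snd e (coord e (snd d z))" if "z \<in> ?W" for z
        using that blow_down_old_chart[OF d] by (simp add: snd_coord)
    qed (use smooth_chart_inj[OF e] in auto)
  qed
  have new: "smooth_in_charts (new_chart i) e (blow_down c)" if e: "smooth_chart M e" for i e
  proof -
    let ?T = "in_charts c e (\<lambda>p. p)"
    let ?V = "{q \<in> U. \<phi> q \<in> cimage e}"
    let ?W = "{w \<in> UNIV. affine_point i w \<in> ?V}"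
    note ce = smooth_charts_compatible[OF M centre_chart(1) e]
    note W = smooth_on_compose_preimage[OF open_UNIV smooth_in_charts_open[OF ce]
        smooth_affine_point[OF open_UNIV] smooth_in_charts_smooth[OF ce]]
    show ?thesis
    proof (rule smooth_in_chartsI(1)[where W = ?W and g = "\<lambda>w. ?T (affine_point i w)"])
      show "open ?W" "smooth_on ?W (\<lambda>w. ?T (affine_point i w))"
        by (rule W)+
      show "inj_on (snd e) (fst e)"
        using smooth_chart_inj[OF e] .
    qed (auto simp: fst_new_chart blow_down_new_chart coord_in snd_coord simp del: image_iff)
  qed
  show "smooth_in_charts C e (blow_down c)" if "C \<in> atlas Bl" "e \<in> atlas M" for C e
  proof -
    have e: "smooth_chart M e"
      by (rule atlas_smooth_chart[OF M that(2)])
    from that(1) consider d where "d \<in> atlas M" "C = old_chart d" | i where "C = new_chart i"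
      unfolding atlas_blowup by blast
    then show ?thesis
    proof cases
      case 1
      then show ?thesis
        using old[OF atlas_smooth_chart[OF M 1(1)] e] by simp
    next
      case 2
      then show ?thesis
        using new[OF e] by simp
    qed
  qed
  show "blow_down c ` pts Bl \<subseteq> pts M"
    using blow_down_pts by blast
qed

lemma d_blow_down_old_chart:
  assumes d: "smooth_chart M d" and z: "z \<in> fst (old_chart d)"
  shows "d_in_charts (old_chart d) d (blow_down c) z v = v"
proof -
  have "(in_charts (old_chart d) d (blow_down c) has_derivative (\<lambda>v. v)) (at z)"
    by (rule has_derivative_transform_within_open[OF has_derivative_ident open_old_chart[OF d] z])
      (simp add: blow_down_old_chart[OF d], simp add: fst_old_chart coord_snd[OF d])
  from frechet_derivative_at[OF this] show ?thesis
    by metis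
qed

lemma d_blow_down_new_chart:
  assumes w: "w \<in> fst (new_chart i)"
  shows "d_in_charts (new_chart i) c (blow_down c) w = d_affine_point i w"
proof -
  have "(in_charts (new_chart i) c (blow_down c) has_derivative d_affine_point i w) (at w)"
    by (rule has_derivative_transform_within_open[OF has_derivative_affine_point open_new_chart w])
      (simp add: fst_new_chart blow_down_new_chart coord_snd[OF centre_chart(1)])
  from frechet_derivative_at[OF this] show ?thesis
    by (rule sym)
qed

end


section \<open>The almost complex structure of the blow-up\<close>

locale blowup_on_line_chart = blowup_at M x c for M :: "('a, complex ^ 'n) mfd" and x c +
  fixes J :: "('a, complex ^ 'n) tangent_endo"
  assumes J: "almost_complex_structure M J"
    and line: "\<And>q v. q \<in> fst c \<Longrightarrow> pullback_endo M J c q v - \<i> *s v \<in> vec.span {q}"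
begin

text \<open>With \<open>target_chart\<close> as the chart of \<open>M\<close>, the projection is expressed by the identity in the charts
  that come from \<open>M\<close> and by \<open>affine_point i\<close> in the affine charts. This allows a common
  treatment of both kinds of charts.\<close>

definition chart_index :: "(('a, complex ^ 'n) chart + 'n) set" where
  "chart_index = Inl ` atlas M \<union> range Inr"

definition blowup_chart ::
  "('a, complex ^ 'n) chart + 'n \<Rightarrow> (('a, 'n) blowup_pre set, complex ^ 'n) chart" where
  "blowup_chart = case_sum old_chart new_chart"

definition target_chart :: "('a, complex ^ 'n) chart + 'n \<Rightarrow> ('a, complex ^ 'n) chart" where
  "target_chart = case_sum (\<lambda>d. d) (\<lambda>_. c)"

definition blowup_endo ::
  "('a, complex ^ 'n) chart + 'n \<Rightarrow> complex ^ 'n \<Rightarrow> complex ^ 'n \<Rightarrow> complex ^ 'n" where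
  "blowup_endo = case_sum (pullback_endo M J) (lifted_endo (pullback_endo M J c))"

lemma index_cases:
  assumes "a \<in> chart_index"
  obtains d where "a = Inl d" "d \<in> atlas M" | i where "a = Inr i"
  using assms by (auto simp: chart_index_def)

lemmas index_defs = blowup_chart_def target_chart_def blowup_endo_def

lemma atlas_index: "atlas Bl = blowup_chart ` chart_index"
  by (simp add: atlas_blowup chart_index_def index_defs image_Un image_image)

lemma pullback_c:
  assumes "q \<in> U"
  shows "linear (pullback_endo M J c q)"
    and "pullback_endo M J c q (pullback_endo M J c q v) = - v"
  using linear_pullback_endo[OF M J chart_at_snd[OF centre_chart(1) assms]]
    pullback_endo_square[OF M J chart_at_snd[OF centre_chart(1) assms]]
  by (simp_all add: coord_snd[OF centre_chart(1) assms])

lemma charts_at: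
  assumes a: "a \<in> chart_index" and P: "P \<in> cimage (blowup_chart a)"
  shows "chart_at Bl P (blowup_chart a)" "chart_at M (blow_down c P) (target_chart a)"
proof -
  show "chart_at Bl P (blowup_chart a)"
    using a P smooth_chart_blowup by (simp add: chart_at_def atlas_index)
  from a show "chart_at M (blow_down c P) (target_chart a)"
  proof (cases rule: index_cases)
    case (1 d)
    have d: "smooth_chart M d"
      using atlas_smooth_chart[OF M 1(2)] .
    obtain z where "z \<in> fst (old_chart d)" "P = snd (old_chart d) z"
      using P 1 by (auto simp: index_defs)
    then show ?thesis
      using 1 d blow_down_old_chart[OF d] by (auto simp: index_defs chart_at_def fst_old_chart)
  next
    case (2 i)
    then show ?thesis
      using P centre_chart(1) blow_down_new_chart by (auto simp: index_defs chart_at_def fst_new_chart)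
  qed
qed

text \<open>This is pseudoholomorphicity of the projection in charts, and it is also what makes the local
  structures compatible.\<close>

lemma blowup_endo_intertwines:
  assumes a: "a \<in> chart_index" and P: "P \<in> cimage (blowup_chart a)"
  defines "D \<equiv> d_in_charts (blowup_chart a) (target_chart a) (blow_down c) (coord (blowup_chart a) P)"
  shows "D (blowup_endo a (coord (blowup_chart a) P) v) =
    pullback_endo M J (target_chart a) (coord (target_chart a) (blow_down c P)) (D v)"
  using a
proof (cases rule: index_cases)
  case (1 d)
  have d: "smooth_chart M d"
    using atlas_smooth_chart[OF M 1(2)] .
  obtain z where z: "z \<in> fst (old_chart d)" "P = snd (old_chart d) z"
    using P 1 by (auto simp: index_defs)
  then have "coord (old_chart d) P = z" "coord d (blow_down c P) = z"
    using inj_old_chart[OF d] blow_down_old_chart[OF d] coord_snd[OF d] by (auto simp: fst_old_chart)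
  then show ?thesis
    using 1 d_blow_down_old_chart[OF d z(1)] by (simp add: D_def index_defs)
next
  case (2 i)
  obtain w where w: "w \<in> fst (new_chart i)" "P = snd (new_chart i) w"
    using P 2 by (auto simp: index_defs)
  then have "coord (new_chart i) P = w" "coord c (blow_down c P) = affine_point i w"
    using inj_new_chart blow_down_new_chart coord_snd[OF centre_chart(1)] by (auto simp: fst_new_chart)
  then show ?thesis
    using 2 d_blow_down_new_chart[OF w(1)] w(1) line
    by (simp add: D_def index_defs fst_new_chart lifted_endo_intertwines)
qed

text \<open>Two of the local structures agree wherever the differential of the projection is injective in the
  second chart, because both are intertwined by it with \<open>J\<close>. In the remaining case the point lies on
  the exceptional divisor, both charts are affine, and both structures are multiplication with
  \<open>\<i>\<close>.\<close>

lemma blowup_endo_transition: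
  assumes a: "a \<in> chart_index" and b: "b \<in> chart_index"
    and Pa: "P \<in> cimage (blowup_chart a)" and Pb: "P \<in> cimage (blowup_chart b)"
  defines "T \<equiv> d_in_charts (blowup_chart a) (blowup_chart b) (\<lambda>P. P) (coord (blowup_chart a) P)"
  shows "T (blowup_endo a (coord (blowup_chart a) P) v) = blowup_endo b (coord (blowup_chart b) P) (T v)"
proof -
  let ?A = "blowup_chart a" and ?B = "blowup_chart b"
  let ?s = "target_chart a" and ?t = "target_chart b"
  let ?Da = "d_in_charts ?A ?s (blow_down c) (coord ?A P)"
  let ?Db = "d_in_charts ?B ?t (blow_down c) (coord ?B P)"
  let ?S = "d_in_charts ?s ?t (\<lambda>p. p) (coord ?s (blow_down c P))"
  note at = charts_at[OF a Pa] charts_at[OF b Pb]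
  note Bl = smooth_manifold_blowup
  have comm: "?Db (T u) = ?S (?Da u)" for u
    unfolding T_def
    using d_in_charts_compose[OF Bl Bl M smooth_map_ident[OF Bl] smooth_map_blow_down at(1,3,4)]
      d_in_charts_compose[OF Bl M M smooth_map_blow_down smooth_map_ident[OF M] at(1,2,4)]
    by simp
  have *: "?Db (T (blowup_endo a (coord ?A P) v)) = ?Db (blowup_endo b (coord ?B P) (T v))"
    using pullback_endo_transition[OF M J at(2,4)]
    by (simp add: comm blowup_endo_intertwines[OF a Pa] blowup_endo_intertwines[OF b Pb])
  show ?thesis
  proof (cases "inj ?Db")
    case True
    then show ?thesis
      using * by (simp add: inj_def)
  next
    case False
    have "\<exists>j. b = Inr j"
      using b
    proof (cases rule: index_cases)
      case (1 d)
      have d: "smooth_chart M d"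
        using atlas_smooth_chart[OF M 1(2)] .
      have "coord ?B P \<in> fst (old_chart d)"
        using coord_in[OF Pb] 1 by (simp add: index_defs)
      then have "?Db = (\<lambda>v. v)"
        using d_blow_down_old_chart[OF d] 1 by (auto simp: index_defs)
      then show ?thesis
        using False by simp
    qed simp
    then obtain j where j: "b = Inr j" ..
    define w where "w = coord ?B P"
    have w: "w \<in> fst (new_chart j)" "P = snd (new_chart j) w"
      using coord_in[OF Pb] snd_coord[OF Pb] j by (simp_all add: w_def index_defs)
    have Db: "?Db = d_affine_point j w"
      using d_blow_down_new_chart[OF w(1)] j by (simp add: w_def index_defs)
    then have wj: "w $ j = 0"
      using False inj_d_affine_point by fastforce
    then have down: "blow_down c P = x"
      using w blow_down_new_chart[of w j] centre_chart(3) by (simp add: fst_new_chart)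
    have "\<exists>i. a = Inr i"
      using a
    proof (cases rule: index_cases)
      case (1 d)
      obtain z where "z \<in> fst (old_chart d)" "P = snd (old_chart d) z"
        using Pa 1 by (auto simp: index_defs)
      then have "blow_down c P \<noteq> x"
        using blow_down_old_chart[of d z] atlas_smooth_chart[OF M 1(2)] by (simp add: fst_old_chart)
      then show ?thesis
        using down by simp
    qed simp
    then obtain i where i: "a = Inr i" ..
    define u where "u = coord ?A P"
    have u: "u \<in> fst (new_chart i)" "P = snd (new_chart i) u"
      using coord_in[OF Pa] snd_coord[OF Pa] i by (simp_all add: u_def index_defs)
    have uU: "affine_point i u \<in> U"
      using u(1) by (simp add: fst_new_chart)
    then have "\<phi> (affine_point i u) = x"
      using down u(2) blow_down_new_chart by metis
    then have ui: "u $ i = 0"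
      unfolding \<phi>_eq_x_iff[OF uU] by simp
    have Ka: "blowup_endo a u h = \<i> *s h" for h
      using lifted_endo_exceptional[where J = "pullback_endo M J c", OF line ui] u(1) i
      by (simp add: index_defs fst_new_chart)
    have Kb: "blowup_endo b w h = \<i> *s h" for h
      using lifted_endo_exceptional[where J = "pullback_endo M J c", OF line wj] w(1) j
      by (simp add: index_defs fst_new_chart)
    have uj: "affine_vec i u $ j \<noteq> 0"
      using Pb new_new_smooth(3)[OF u(1), of j] u(2) j by (simp add: index_defs)
    obtain T' where T': "((\<lambda>w. affine_coord j (affine_point i w) (affine_vec i w)) has_derivative T') (at u)"
      and T'_scale: "\<And>h. T' (\<i> *s h) = \<i> *s T' h"
      using affine_transition_derivative[OF uj] by blast
    let ?W = "fst (new_chart i) \<inter> {w. affine_vec i w \<in> {v. v $ j \<noteq> 0}}"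
    have "open ?W"
      by (intro open_Int open_new_chart open_affine_vec_preimage open_Collect_neq continuous_intros)
    then have "(in_charts (new_chart i) (new_chart j) (\<lambda>P. P) has_derivative T') (at u)"
      using u(1) uj by (intro has_derivative_transform_within_open[OF T', of ?W])
        (auto simp: new_new_smooth(2))
    from frechet_derivative_at[OF this] have "T = T'"
      using i j unfolding T_def u_def by (simp add: index_defs)
    then show ?thesis
      using Ka Kb T'_scale unfolding u_def w_def by simp
  qed
qed

sublocale blowup: local_endos Bl chart_index blowup_chart blowup_endo
  using smooth_manifold_blowup atlas_index blowup_endo_transition by unfold_locales

abbreviation "Jt \<equiv> glued_endo Bl chart_index blowup_chart blowup_endo"

lemma almost_complex_structure_blowup: "almost_complex_structure Bl Jt"
proof (rule blowup.almost_complex_structure_glued_endo)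
  have *: "linear (blowup_endo a q) \<and> (\<forall>v. blowup_endo a q (blowup_endo a q v) = - v)"
    if a: "a \<in> chart_index" and q: "q \<in> fst (blowup_chart a)" for a q
    using a
  proof (cases rule: index_cases)
    case (1 d)
    have d: "smooth_chart M d" "q \<in> fst d"
      using atlas_smooth_chart[OF M 1(2)] q 1 by (auto simp: index_defs fst_old_chart)
    show ?thesis
      using linear_pullback_endo[OF M J chart_at_snd[OF d]]
        pullback_endo_square[OF M J chart_at_snd[OF d]] 1
      by (simp add: coord_snd[OF d] index_defs)
  next
    case (2 i)
    have "affine_point i q \<in> U"
      using q 2 by (simp add: index_defs fst_new_chart)
    then show ?thesis
      using 2 pullback_c line by (simp add: index_defs linear_lifted_endo lifted_endo_square)
  qed
  show "linear (blowup_endo a q)" if "a \<in> chart_index" "q \<in> fst (blowup_chart a)" for a q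
    using *[OF that] by blast
  show "blowup_endo a q (blowup_endo a q v) = - v"
    if "a \<in> chart_index" "q \<in> fst (blowup_chart a)" for a q v
    using *[OF that] by blast
  show "smooth_on (fst (blowup_chart a)) (\<lambda>q. blowup_endo a q v)" if a: "a \<in> chart_index" for a v
    using a
  proof (cases rule: index_cases)
    case (1 d)
    have "smooth_on (fst d) (\<lambda>q. pullback_endo M J d q v)"
      using smooth_pullback_endo[OF M J atlas_smooth_chart[OF M 1(2)]] .
    then show ?thesis
      using 1 by (auto simp: index_defs fst_old_chart intro: smooth_on_subset)
  next
    case (2 i)
    then show ?thesis
      using smooth_lifted_endo[OF open_U pullback_c(1) smooth_pullback_endo[OF M J centre_chart(1)]]
      by (simp add: index_defs fst_new_chart)
  qed
qed

lemma pseudoholomorphic_blow_down: "pseudoholomorphic Bl Jt M J (blow_down c)"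
proof (rule pseudoholomorphicI[OF smooth_manifold_blowup M almost_complex_structure_blowup J
      smooth_map_blow_down])
  fix P assume "P \<in> pts Bl"
  with smooth_manifold_blowup obtain C where "C \<in> atlas Bl" "P \<in> cimage C"
    by (rule atlas_covers)
  then obtain a where a: "a \<in> chart_index" "P \<in> cimage (blowup_chart a)"
    unfolding atlas_index by blast
  have "pullback_endo Bl Jt (blowup_chart a) (coord (blowup_chart a) P) v =
      blowup_endo a (coord (blowup_chart a) P) v" for v
    using blowup.pullback_glued_endo[OF a(1) coord_in[OF a(2)]] .
  then show "\<exists>C d. chart_at Bl P C \<and> chart_at M (blow_down c P) d \<and>
      (\<forall>v. pullback_endo M J d (coord d (blow_down c P)) (d_in_charts C d (blow_down c) (coord C P) v) =
        d_in_charts C d (blow_down c) (coord C P) (pullback_endo Bl Jt C (coord C P) v))"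
    using charts_at[OF a] blowup_endo_intertwines[OF a]
    by (intro exI[of _ "blowup_chart a"] exI[of _ "target_chart a"]) simp
qed

lemma almost_complex_blowup: "almost_complex_blowup M J x Bl Jt"
  unfolding almost_complex_blowup_def almost_complex_blowup_wrt_def almost_complex_manifold_def
  using origin smooth_manifold_blowup almost_complex_structure_blowup pseudoholomorphic_blow_down
  by blast

end

theorem theorem5p5:
  fixes M :: "('a, complex ^ 'n) mfd"
    and J :: "('a, complex ^ 'n) tangent_endo"
    and x :: 'a
  assumes "almost_complex_manifold M J"
    and "x \<in> pts M"
    and "line_condition M J x"
  shows "\<exists>Mt Jt. almost_complex_blowup M J x Mt Jt"
proof -
  from assms(3) obtain c where "smooth_local_chart_at_origin M x c"
    and "\<And>q v. q \<in> fst c \<Longrightarrow> pullback_endo M J c q v - \<i> *s v \<in> vec.span {q}"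
    unfolding line_condition_def by blast
  then interpret blowup_on_line_chart M x c J
    using assms(1) by unfold_locales (auto simp: almost_complex_manifold_def)
  show ?thesis
    using almost_complex_blowup by blast
qed

end
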